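(* Every selection-orderable quasi-king space is compact.
   Context: All spaces are Hausdorff topological spaces. For a set $X$, let $\mathscr{F}_2(X)=\{S\subset X: 1\le |S|\le 2\}$. A weak selection for $X$ is a map $\sigma:\mathscr{F}_2(X)\to X$ with $\sigma(S)\in S$ for every $S\in\mathscr{F}_2(X)$. It generates the (total, antisymmetric, not necessarily transitive) relation $x\leq_\sigma y$ iff $\sigma(\{x,y\})=x$; write $x<_\sigma y$ if $x\leq_\sigma y$ and $x\neq y$. The selection topology $\mathscr{T}_\sigma$ on $X$ is the topology with subbase consisting of all sets $\{y\in X: y<_\sigma x\}$ and $\{y\in X: x<_\sigma y\}$, $x\in X$. A weak selection $\sigma$ for a topological space is continuous if for every $x,y\in X$ with $x<_\sigma y$ there are open sets $U\ni x$, $V\ni y$ with $s<_\sigma t$ for all $s\in U$, $t\in V$. A weak selection $\sigma$ for a space $(X,\mathscr{T})$ is separately continuous if $\mathscr{T}_\sigma\subset\mathscr{T}$. A space $(X,\mathscr{T})$ is selection-orderable if it has a continuous weak selection $\varphi$ with $\mathscr{T}=\mathscr{T}_\varphi$. A point $q\in X$ is a quasi $\sigma$-king if for each $x\in X$ there are finitely many points $y_1,\dots,y_n\in X$ with $x\leq_\sigma y_1\leq_\sigma\dots\leq_\sigma y_n\leq_\sigma q$. A space $X$ is quasi-king if it has a separately continuous weak selection, and every separately continuous weak selection $\sigma$ for $X$ has a quasi $\sigma$-king. *)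

theory Defs
  imports "HOL-Analysis.Analysis"
begin

definition F2 :: "'a set \<Rightarrow> 'a set set" where
  "F2 X = {S. S \<subseteq> X \<and> 1 \<le> card S \<and> card S \<le> 2}"

text \<open>Only the values of a weak selection on \<open>F2 X\<close> matter; every notion below
  evaluates it on that family only.\<close>

definition weak_selection :: "'a set \<Rightarrow> ('a set \<Rightarrow> 'a) \<Rightarrow> bool" where
  "weak_selection X \<sigma> \<longleftrightarrow> (\<forall>S \<in> F2 X. \<sigma> S \<in> S)"

definition sel_le :: "('a set \<Rightarrow> 'a) \<Rightarrow> 'a \<Rightarrow> 'a \<Rightarrow> bool" where
  "sel_le \<sigma> x y \<longleftrightarrow> \<sigma> {x, y} = x"

definition sel_less :: "('a set \<Rightarrow> 'a) \<Rightarrow> 'a \<Rightarrow> 'a \<Rightarrow> bool" where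
  "sel_less \<sigma> x y \<longleftrightarrow> sel_le \<sigma> x y \<and> x \<noteq> y"

text \<open>The library's \<open>topology_generated_by S\<close> has underlying set \<open>\<Union>S\<close>. Inserting \<open>X\<close>
  (the empty intersection of subbasic sets) ensures that the underlying set is \<open>X\<close> also
  when \<open>X\<close> is a singleton and the rays are empty.\<close>

definition selection_topology :: "'a set \<Rightarrow> ('a set \<Rightarrow> 'a) \<Rightarrow> 'a topology" where
  "selection_topology X \<sigma> = topology_generated_by
     (insert X ({{y \<in> X. sel_less \<sigma> y x} |x. x \<in> X} \<union> {{y \<in> X. sel_less \<sigma> x y} |x. x \<in> X}))"

definition continuous_weak_selection :: "'a topology \<Rightarrow> ('a set \<Rightarrow> 'a) \<Rightarrow> bool" where
  "continuous_weak_selection T \<sigma> \<longleftrightarrow>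
     weak_selection (topspace T) \<sigma> \<and>
     (\<forall>x \<in> topspace T. \<forall>y \<in> topspace T. sel_less \<sigma> x y \<longrightarrow>
        (\<exists>U V. openin T U \<and> openin T V \<and> x \<in> U \<and> y \<in> V \<and>
               (\<forall>s \<in> U. \<forall>t \<in> V. sel_less \<sigma> s t)))"

definition separately_continuous_weak_selection :: "'a topology \<Rightarrow> ('a set \<Rightarrow> 'a) \<Rightarrow> bool" where
  "separately_continuous_weak_selection T \<sigma> \<longleftrightarrow>
     weak_selection (topspace T) \<sigma> \<and>
     (\<forall>U. openin (selection_topology (topspace T) \<sigma>) U \<longrightarrow> openin T U)"

definition selection_orderable :: "'a topology \<Rightarrow> bool" where
  "selection_orderable T \<longleftrightarrow>
     (\<exists>\<phi>. continuous_weak_selection T \<phi> \<and> T = selection_topology (topspace T) \<phi>)"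

text \<open>\<open>successively\<close> relates consecutive entries only, as needed for a relation that
  need not be transitive.\<close>

definition quasi_king :: "'a set \<Rightarrow> ('a set \<Rightarrow> 'a) \<Rightarrow> 'a \<Rightarrow> bool" where
  "quasi_king X \<sigma> q \<longleftrightarrow>
     q \<in> X \<and> (\<forall>x \<in> X. \<exists>ys. set ys \<subseteq> X \<and> successively (sel_le \<sigma>) (x # ys @ [q]))"

definition quasi_king_space :: "'a topology \<Rightarrow> bool" where
  "quasi_king_space T \<longleftrightarrow>
     (\<exists>\<sigma>. separately_continuous_weak_selection T \<sigma>) \<and>
     (\<forall>\<sigma>. separately_continuous_weak_selection T \<sigma> \<longrightarrow> (\<exists>q. quasi_king (topspace T) \<sigma> q))"

end

theory Submission
  imports Defs
begin

text \<open>
  The hypothesis on quasi-kings is applied to tournaments derived from the given one: compare two points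
  first by a locally constant natural-valued rank and then by the given relation. The result is again
  separately continuous, and its quasi-king has the largest rank. So locally constant ranks are bounded
  (\<open>locally_constant_rank_bounded\<close>), a form of pseudocompactness, and
  every nonempty clopen set has a quasi-king of its own (\<open>clopen_quasi_king\<close>).

  Each quasi-component is linearly ordered, and by the above it has a minimum and a maximum. A point
  outside it lies below or above it as a whole. Continuity at the endpoints then shows that different
  quasi-components have clopen neighbourhoods one of which lies entirely below the other
  (\<open>clopen_below_clopen\<close>), so as far as clopen sets are concerned the space behaves like a
  zero-dimensional one.

  Boundedness of ranks makes every sequence of disjoint nonempty clopen sets accumulate, and an ascending
  sequence converges to its cluster point. Therefore such sequences have convergent subsequences, products of two clopen
  sets are pseudocompact too, and for disjoint clopen sets \<open>M\<close> and \<open>C\<close> only finitely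
  many sets \<open>C \<inter> below m\<close> with \<open>m \<in> M\<close> occur (\<open>finite_traces\<close>). In
  effect the tournament extends continuously to the compact space of ultrafilters of clopen sets.

  Now suppose that such an ultrafilter \<open>p\<close> has empty intersection. The points below \<open>p\<close>
  form a clopen set \<open>A\<close>, and \<open>A \<in> p\<close> without loss of generality, by reversing the
  tournament. Let \<open>q\<close> be a quasi-king of \<open>A\<close>. For each \<open>n\<close> the points that
  reach \<open>q\<close> in at most \<open>n\<close> steps stay away from \<open>p\<close>, since this property
  passes from a clopen set to the set of its predecessors. Hence there are clopen neighbourhoods of
  \<open>p\<close> in \<open>A\<close> that decrease to the empty set, and the index at which a point leaves them is an unbounded
  rank. So every ultrafilter of clopen sets has a nonempty intersection
  (\<open>prime_clopen_ideal_fixed\<close>, stated for the complementary prime ideals).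

  What remains is the situation around a single quasi-component. It is a linearly ordered set with both
  endpoints and without gaps, since a gap would cut it by a clopen set. The usual argument for compactness of
  such orders, with the Alexander subbase theorem, finishes the proof.
\<close>

section \<open>Clopen sets\<close>

definition clopenin :: "'a topology \<Rightarrow> 'a set \<Rightarrow> bool" where
  "clopenin T U \<longleftrightarrow> closedin T U \<and> openin T U"

lemma clopenin_subset: "clopenin T U \<Longrightarrow> U \<subseteq> topspace T"
  by (simp add: clopenin_def openin_subset)

lemma clopenin_empty [simp]: "clopenin T {}"
  and clopenin_topspace [simp]: "clopenin T (topspace T)"
  by (auto simp: clopenin_def)

lemma clopenin_Int: "clopenin T U \<Longrightarrow> clopenin T V \<Longrightarrow> clopenin T (U \<inter> V)"
  and clopenin_Un: "clopenin T U \<Longrightarrow> clopenin T V \<Longrightarrow> clopenin T (U \<union> V)"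
  and clopenin_Diff: "clopenin T U \<Longrightarrow> clopenin T V \<Longrightarrow> clopenin T (U - V)"
  by (auto simp: clopenin_def intro: openin_diff closedin_diff)

lemma clopenin_Union: "finite \<U> \<Longrightarrow> (\<And>U. U \<in> \<U> \<Longrightarrow> clopenin T U) \<Longrightarrow> clopenin T (\<Union>\<U>)"
  by (induction rule: finite_induct) (auto intro: clopenin_Un)

lemma clopeninI_local:
  assumes "A \<subseteq> topspace T"
    and "\<And>x. x \<in> A \<Longrightarrow> \<exists>U. openin T U \<and> x \<in> U \<and> U \<subseteq> A"
    and "\<And>x. x \<in> topspace T - A \<Longrightarrow> \<exists>U. openin T U \<and> x \<in> U \<and> U \<inter> A = {}"
  shows "clopenin T A"
proof -
  have "openin T A"
    using assms(2) by (subst openin_subopen) blast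
  moreover have "openin T (topspace T - A)"
    using assms(3) by (subst openin_subopen) (metis DiffI IntI empty_iff openin_subset subset_iff)
  ultimately show ?thesis
    using assms(1) by (simp add: clopenin_def closedin_def)
qed

text \<open>Passing to the complement, if necessary, puts \<open>x\<close> inside the separating clopen set.\<close>

lemma quasi_component_separation:
  assumes "x \<in> topspace T" "y \<in> topspace T" "\<not> quasi_component_of T x y"
  obtains U where "clopenin T U" "x \<in> U" "y \<notin> U"
proof -
  obtain U where U: "clopenin T U" "x \<in> U \<longleftrightarrow> y \<notin> U"
    using assms unfolding quasi_component_of_def clopenin_def by blast
  show thesis
  proof (cases "x \<in> U")
    case True
    then show thesis using U that by blast
  next
    case False
    then show thesis
      using U assms that[of "topspace T - U"] clopenin_Diff[OF clopenin_topspace U(1)] by blast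
  qed
qed

lemma quasi_component_in_clopen:
  "quasi_component_of T x y \<Longrightarrow> clopenin T U \<Longrightarrow> x \<in> U \<Longrightarrow> y \<in> U"
  by (simp add: quasi_component_of_def clopenin_def)

section \<open>Prime ideals of clopen sets\<close>

text \<open>These ideals are the complements of the ultrafilters of clopen sets. A free one, covering the whole
  space, plays the role of a point missing from the space; its members are the clopen sets that stay
  away from that point. Closure under subsets and finite unions is put into one clause.\<close>

definition prime_clopen_ideal :: "'a topology \<Rightarrow> 'a set set \<Rightarrow> bool" where
  "prime_clopen_ideal T J \<longleftrightarrow>
     (\<forall>U\<in>J. clopenin T U) \<and> topspace T \<notin> J \<and>
     (\<forall>U. clopenin T U \<longrightarrow> U \<in> J \<or> topspace T - U \<in> J) \<and>
     (\<forall>U \<F>. clopenin T U \<longrightarrow> finite \<F> \<longrightarrow> \<F> \<subseteq> J \<longrightarrow> U \<subseteq> \<Union>\<F> \<longrightarrow> U \<in> J)"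

lemma prime_clopen_idealD:
  assumes "prime_clopen_ideal T J"
  shows "U \<in> J \<Longrightarrow> clopenin T U" "topspace T \<notin> J"
    "clopenin T U \<Longrightarrow> U \<notin> J \<Longrightarrow> topspace T - U \<in> J"
    "clopenin T U \<Longrightarrow> finite \<F> \<Longrightarrow> \<F> \<subseteq> J \<Longrightarrow> U \<subseteq> \<Union>\<F> \<Longrightarrow> U \<in> J"
proof -
  note * = assms[unfolded prime_clopen_ideal_def]
  show "U \<in> J \<Longrightarrow> clopenin T U" "topspace T \<notin> J"
    "clopenin T U \<Longrightarrow> U \<notin> J \<Longrightarrow> topspace T - U \<in> J"
    using * by simp_all (use * in blast)
  show "clopenin T U \<Longrightarrow> finite \<F> \<Longrightarrow> \<F> \<subseteq> J \<Longrightarrow> U \<subseteq> \<Union>\<F> \<Longrightarrow> U \<in> J"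
    by (rule *[THEN conjunct2, THEN conjunct2, THEN conjunct2, rule_format])
qed

lemma prime_clopen_ideal_Un:
  assumes "prime_clopen_ideal T J" "clopenin T U" "V \<in> J" "W \<in> J" "U \<subseteq> V \<union> W"
  shows "U \<in> J"
  by (rule prime_clopen_idealD(4)[OF assms(1,2), of "{V, W}"]) (use assms(3-5) in auto)

lemma prime_clopen_ideal_compl:
  assumes "prime_clopen_ideal T J" "U \<in> J"
  shows "topspace T - U \<notin> J"
proof
  assume "topspace T - U \<in> J"
  then have "topspace T \<in> J"
    by (rule prime_clopen_ideal_Un[OF assms(1) clopenin_topspace assms(2)]) blast
  then show False
    using prime_clopen_idealD(2)[OF assms(1)] by simp
qed

text \<open>The prime ideal theorem for the algebra of clopen sets. The maximal family is only required to have
  no finite subfamily covering the space; that it is an ideal then follows from maximality.\<close>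

lemma prime_clopen_ideal_extension:
  assumes I: "\<And>U. U \<in> I \<Longrightarrow> clopenin T U"
    and proper: "\<And>\<F>. finite \<F> \<Longrightarrow> \<F> \<subseteq> I \<Longrightarrow> \<Union>\<F> \<noteq> topspace T"
  obtains J where "I \<subseteq> J" "prime_clopen_ideal T J"
proof -
  let ?X = "topspace T"
  define \<A> where "\<A> = {J. I \<subseteq> J \<and> (\<forall>U\<in>J. clopenin T U) \<and>
    (\<forall>\<F>. finite \<F> \<longrightarrow> \<F> \<subseteq> J \<longrightarrow> \<Union>\<F> \<noteq> ?X)}"
  have "\<exists>J\<in>\<A>. \<forall>K\<in>\<A>. J \<subseteq> K \<longrightarrow> K = J"
  proof (rule subset_Zorn_nonempty)
    show "\<A> \<noteq> {}"
      using I proper by (auto simp: \<A>_def)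
    fix \<C> assume \<C>: "\<C> \<noteq> {}" "subset.chain \<A> \<C>"
    have mem: "K \<in> \<A>" if "K \<in> \<C>" for K
      using \<C>(2) that by (auto simp: subset_chain_def)
    have "\<Union>\<F> \<noteq> ?X" if \<F>: "finite \<F>" "\<F> \<subseteq> \<Union>\<C>" for \<F>
    proof -
      obtain K where "K \<in> \<C>" "\<F> \<subseteq> K"
        using finite_subset_Union_chain[OF \<F> \<C>] .
      then show ?thesis
        using mem \<F>(1) by (simp add: \<A>_def)
    qed
    moreover have "I \<subseteq> \<Union>\<C>"
    proof -
      obtain K where "K \<in> \<C>"
        using \<C>(1) by blast
      then show ?thesis
        using mem[of K] by (auto simp: \<A>_def)
    qed
    moreover have "clopenin T U" if U: "U \<in> \<Union>\<C>" for U
    proof -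
      obtain K where "K \<in> \<C>" "U \<in> K"
        using U by blast
      then show ?thesis
        using mem[of K] by (simp add: \<A>_def)
    qed
    ultimately show "\<Union>\<C> \<in> \<A>"
      by (simp add: \<A>_def)
  qed
  then obtain J where J: "J \<in> \<A>" and maximal: "\<And>K. K \<in> \<A> \<Longrightarrow> J \<subseteq> K \<Longrightarrow> K = J"
    by blast
  have clo: "\<And>U. U \<in> J \<Longrightarrow> clopenin T U" and fin: "\<And>\<F>. finite \<F> \<Longrightarrow> \<F> \<subseteq> J \<Longrightarrow> \<Union>\<F> \<noteq> ?X"
    and IJ: "I \<subseteq> J"
    using J by (auto simp: \<A>_def)
  have cover: "\<exists>\<F>. finite \<F> \<and> \<F> \<subseteq> J \<and> ?X \<subseteq> U \<union> \<Union>\<F>" if U: "clopenin T U" "U \<notin> J" for U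
  proof -
    have "insert U J \<notin> \<A>"
      using maximal[of "insert U J"] U(2) by blast
    then obtain \<F> where "finite \<F>" "\<F> \<subseteq> insert U J" "\<Union>\<F> = ?X"
      using U(1) clo IJ by (auto simp: \<A>_def)
    then show ?thesis
      by (intro exI[of _ "\<F> - {U}"]) auto
  qed
  have compl: "?X - U \<in> J" if U: "clopenin T U" "U \<notin> J" for U
  proof (rule ccontr)
    assume neg: "?X - U \<notin> J"
    obtain \<F> where \<F>: "finite \<F>" "\<F> \<subseteq> J" "?X \<subseteq> U \<union> \<Union>\<F>"
      using cover[OF U] by blast
    obtain \<G> where \<G>: "finite \<G>" "\<G> \<subseteq> J" "?X \<subseteq> (?X - U) \<union> \<Union>\<G>"
      using cover[OF clopenin_Diff[OF clopenin_topspace U(1)] neg] by blast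
    have "\<Union>(\<F> \<union> \<G>) \<subseteq> ?X"
      using \<F>(2) \<G>(2) clo clopenin_subset by blast
    moreover have "?X \<subseteq> \<Union>(\<F> \<union> \<G>)"
      using \<F>(3) \<G>(3) by blast
    ultimately show False
      using fin[of "\<F> \<union> \<G>"] \<F> \<G> by blast
  qed
  have covered: "U \<in> J" if U: "clopenin T U" "finite \<F>" "\<F> \<subseteq> J" "U \<subseteq> \<Union>\<F>" for U \<F>
  proof (rule ccontr)
    assume "U \<notin> J"
    then have "?X - U \<in> J"
      using compl U(1) by blast
    moreover have "\<Union>\<F> \<subseteq> ?X"
      using U(3) clo clopenin_subset by blast
    then have "\<Union>(insert (?X - U) \<F>) = ?X"
      using U(4) by auto
    ultimately show False
      using fin[of "insert (?X - U) \<F>"] U(2,3) by auto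
  qed
  have "prime_clopen_ideal T J"
    unfolding prime_clopen_ideal_def
  proof (intro conjI allI impI ballI)
    show "?X \<notin> J"
      using fin[of "{?X}"] by auto
    show "U \<in> J \<or> ?X - U \<in> J" if "clopenin T U" for U
      using compl[OF that] by blast
  qed (rule clo covered; assumption)+
  then show thesis
    using IJ that by blast
qed

section \<open>Compactness from a subbase\<close>

text \<open>The Alexander subbase theorem. Requiring \<open>\<Union>S \<in> S\<close> makes the empty intersection of subbasic
  sets harmless.\<close>

lemma generated_topology_compact:
  assumes S: "\<Union>S \<in> S"
    and fin: "\<And>\<C>. \<lbrakk>\<C> \<subseteq> S; \<Union>\<C> = \<Union>S\<rbrakk> \<Longrightarrow> \<exists>\<F>. finite \<F> \<and> \<F> \<subseteq> \<C> \<and> \<Union>\<F> = \<Union>S"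
  shows "compact_space (topology_generated_by S)"
proof (rule Alexander_subbase)
  have "(finite intersection_of (\<lambda>x. x \<in> S) relative_to \<Union>S) = (finite' intersection_of (\<lambda>x. x \<in> S))"
  proof (intro ext iffI)
    fix A assume "(finite intersection_of (\<lambda>x. x \<in> S) relative_to \<Union>S) A"
    then obtain \<F> where \<F>: "finite \<F>" "\<F> \<subseteq> S" "A = \<Union>S \<inter> \<Inter>\<F>"
      by (auto simp: relative_to_def intersection_of_def)
    then show "(finite' intersection_of (\<lambda>x. x \<in> S)) A"
      unfolding intersection_of_def using S by (intro exI[of _ "insert (\<Union>S) \<F>"]) auto
  next
    fix A assume "(finite' intersection_of (\<lambda>x. x \<in> S)) A"
    then obtain \<F> where \<F>: "finite \<F>" "\<F> \<noteq> {}" "\<F> \<subseteq> S" "A = \<Inter>\<F>"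
      by (auto simp: intersection_of_def)
    then have "A = \<Union>S \<inter> \<Inter>\<F>"
      by blast
    moreover have "(finite intersection_of (\<lambda>x. x \<in> S)) (\<Inter>\<F>)"
      using \<F> by (auto simp: intersection_of_def)
    ultimately show "(finite intersection_of (\<lambda>x. x \<in> S) relative_to \<Union>S) A"
      unfolding relative_to_def by blast
  qed
  then show "topology (arbitrary union_of (finite intersection_of (\<lambda>x. x \<in> S) relative_to \<Union>S)) =
      topology_generated_by S"
    by (simp add: generate_topology_on_eq)
  show "\<exists>\<F>. finite \<F> \<and> \<F> \<subseteq> \<C> \<and> \<Union>\<F> = topspace (topology_generated_by S)"
    if "\<C> \<subseteq> S" "\<Union>\<C> = topspace (topology_generated_by S)" for \<C>
    using fin that by simp
qed

section \<open>Tournaments with open rays\<close>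

text \<open>These are the strict relations of the separately continuous weak selections. Relations are easier
  to reverse and to modify than selections, which is how the quasi-kings are used.\<close>

definition open_tournament :: "'a topology \<Rightarrow> ('a \<Rightarrow> 'a \<Rightarrow> bool) \<Rightarrow> bool" where
  "open_tournament T R \<longleftrightarrow>
     (\<forall>x \<in> topspace T. \<forall>y \<in> topspace T. x \<noteq> y \<longrightarrow> R x y \<or> R y x) \<and>
     (\<forall>x \<in> topspace T. \<forall>y \<in> topspace T. R x y \<longrightarrow> \<not> R y x) \<and>
     (\<forall>x \<in> topspace T. openin T {y \<in> topspace T. R y x} \<and> openin T {y \<in> topspace T. R x y})"

text \<open>The tournament is the strict relation of the selection that picks the smaller of two points, and
  its open rays make this selection separately continuous.\<close>

lemma open_tournament_has_quasi_king:
  assumes "quasi_king_space T" and R: "open_tournament T R"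
  shows "\<exists>q \<in> topspace T. \<forall>x \<in> topspace T.
           (\<lambda>u v. u \<in> topspace T \<and> v \<in> topspace T \<and> R u v)\<^sup>*\<^sup>* x q"
proof -
  let ?X = "topspace T"
  define \<sigma> where "\<sigma> S = (THE x. x \<in> S \<and> (\<forall>y\<in>S. y \<noteq> x \<longrightarrow> R x y))" for S
  have total: "x \<noteq> y \<Longrightarrow> R x y \<or> R y x" and asym: "R x y \<Longrightarrow> \<not> R y x"
    if "x \<in> ?X" "y \<in> ?X" for x y
    using R that unfolding open_tournament_def by blast+
  have \<sigma>_eq: "\<sigma> {x, y} = x" if "x \<in> ?X" "y \<in> ?X" "x = y \<or> R x y" for x y
    unfolding \<sigma>_def using that asym[of x y] by (intro the_equality) auto
  have \<sigma>_le: "sel_le \<sigma> x y \<longleftrightarrow> x = y \<or> R x y" if "x \<in> ?X" "y \<in> ?X" for x y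
    unfolding sel_le_def using that \<sigma>_eq[of x y] \<sigma>_eq[of y x] total[of x y]
    by (metis insert_commute)
  have \<sigma>_less: "sel_less \<sigma> x y \<longleftrightarrow> R x y" if "x \<in> ?X" "y \<in> ?X" for x y
    unfolding sel_less_def using that \<sigma>_le[of x y] asym[of x y] by auto
  have "\<sigma> S \<in> S" if S: "S \<in> F2 ?X" for S
  proof -
    have "card S = 1 \<or> card S = 2"
      using S by (auto simp: F2_def)
    then obtain x y where "S = {x, y}"
      by (metis card_1_singletonE card_2_iff insert_absorb2)
    then show ?thesis
      using S \<sigma>_eq[of x y] \<sigma>_eq[of y x] total[of x y] by (auto simp: F2_def insert_commute)
  qed
  then have weak: "weak_selection ?X \<sigma>"
    by (simp add: weak_selection_def)
  have rays: "{y \<in> ?X. sel_less \<sigma> y x} = {y \<in> ?X. R y x}"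
    "{y \<in> ?X. sel_less \<sigma> x y} = {y \<in> ?X. R x y}" if "x \<in> ?X" for x
    using \<sigma>_less that by auto
  have "openin T U" if "openin (selection_topology ?X \<sigma>) U" for U
  proof -
    have "generate_topology_on (insert ?X ({{y \<in> ?X. sel_less \<sigma> y x} |x. x \<in> ?X} \<union>
        {{y \<in> ?X. sel_less \<sigma> x y} |x. x \<in> ?X})) U"
      using that unfolding selection_topology_def by (rule openin_topology_generated_by)
    then show ?thesis
      by (rule generate_topology_on_coarsest[rotated 2])
        (use R in \<open>auto simp: rays open_tournament_def\<close>)
  qed
  then obtain q where q: "quasi_king ?X \<sigma> q"
    using assms(1) weak unfolding quasi_king_space_def separately_continuous_weak_selection_def
    by blast
  have chain: "(\<lambda>u v. u \<in> ?X \<and> v \<in> ?X \<and> R u v)\<^sup>*\<^sup>* x q"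
    if "set ys \<subseteq> ?X" "x \<in> ?X" "successively (sel_le \<sigma>) (x # ys @ [q])" for x ys
    using that
  proof (induction ys arbitrary: x)
    case Nil
    then have "x = q \<or> R x q"
      using \<sigma>_le[of x q] q by (simp add: quasi_king_def)
    then show ?case
      using Nil q by (auto simp: quasi_king_def)
  next
    case (Cons y ys)
    then have "x = y \<or> R x y"
      using \<sigma>_le[of x y] by simp
    moreover have "(\<lambda>u v. u \<in> ?X \<and> v \<in> ?X \<and> R u v)\<^sup>*\<^sup>* y q"
      using Cons by simp
    ultimately show ?case
      using Cons.prems by (auto intro: converse_rtranclp_into_rtranclp)
  qed
  show ?thesis
  proof (intro bexI ballI)
    fix x assume "x \<in> ?X"
    then obtain ys where "set ys \<subseteq> ?X" "successively (sel_le \<sigma>) (x # ys @ [q])"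
      using q unfolding quasi_king_def by blast
    then show "(\<lambda>u v. u \<in> ?X \<and> v \<in> ?X \<and> R u v)\<^sup>*\<^sup>* x q"
      using chain \<open>x \<in> ?X\<close> by blast
  qed (use q in \<open>simp add: quasi_king_def\<close>)
qed

locale continuous_tournament =
  fixes T :: "'a topology" and lt :: "'a \<Rightarrow> 'a \<Rightarrow> bool" (infix "\<sqsubset>" 50)
  assumes total: "\<lbrakk>x \<in> topspace T; y \<in> topspace T; x \<noteq> y\<rbrakk> \<Longrightarrow> x \<sqsubset> y \<or> y \<sqsubset> x"
    and asym: "\<lbrakk>x \<in> topspace T; y \<in> topspace T; x \<sqsubset> y\<rbrakk> \<Longrightarrow> \<not> y \<sqsubset> x"
    and cont: "\<lbrakk>x \<in> topspace T; y \<in> topspace T; x \<sqsubset> y\<rbrakk> \<Longrightarrow>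
      \<exists>U V. openin T U \<and> openin T V \<and> x \<in> U \<and> y \<in> V \<and> (\<forall>s \<in> U. \<forall>t \<in> V. s \<sqsubset> t)"
begin

abbreviation "X \<equiv> topspace T"

definition below :: "'a \<Rightarrow> 'a set" where "below x = {y \<in> X. y \<sqsubset> x}"
definition above :: "'a \<Rightarrow> 'a set" where "above x = {y \<in> X. x \<sqsubset> y}"

lemma dual_continuous_tournament: "continuous_tournament T (\<lambda>x y. y \<sqsubset> x)"
proof
  fix x y assume "x \<in> X" "y \<in> X" "y \<sqsubset> x"
  then show "\<exists>U V. openin T U \<and> openin T V \<and> x \<in> U \<and> y \<in> V \<and> (\<forall>s\<in>U. \<forall>t\<in>V. t \<sqsubset> s)"
    using cont[of y x] by blast
qed (use total asym in metis)+

lemma irrefl: "x \<in> X \<Longrightarrow> \<not> x \<sqsubset> x"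
  using asym[of x x] by blast

lemma openin_below: "x \<in> X \<Longrightarrow> openin T (below x)"
proof (subst openin_subopen, intro ballI)
  fix y assume x: "x \<in> X" and "y \<in> below x"
  then obtain U V where "openin T U" "x \<in> V" "y \<in> U" "\<forall>s \<in> U. \<forall>t \<in> V. s \<sqsubset> t"
    using cont[of y x] by (auto simp: below_def)
  then show "\<exists>W. openin T W \<and> y \<in> W \<and> W \<subseteq> below x"
    using openin_subset[of T U] by (auto simp: below_def intro!: exI[of _ U])
qed

lemma openin_above: "x \<in> X \<Longrightarrow> openin T (above x)"
  using continuous_tournament.openin_below[OF dual_continuous_tournament]
  unfolding above_def continuous_tournament.below_def[OF dual_continuous_tournament] .

text \<open>Away from \<open>x\<close> the space splits into two open rays, so the trace of a ray on a clopen set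
  that misses \<open>x\<close> is clopen.\<close>

lemma clopenin_Int_below:
  assumes "clopenin T U" "x \<in> X - U"
  shows "clopenin T (U \<inter> below x)"
proof -
  have "w \<in> U \<Longrightarrow> \<not> w \<sqsubset> x \<longleftrightarrow> x \<sqsubset> w" if "w \<in> X" for w
    using assms that total[of w x] asym[of w x] by blast
  then have "X - U \<inter> below x = (X - U) \<union> above x"
    using assms irrefl by (auto simp: below_def above_def)
  then have "openin T (X - U \<inter> below x)"
    using assms by (simp add: openin_above clopenin_def openin_Un openin_diff)
  then show ?thesis
    using assms openin_below[of x] clopenin_subset[OF assms(1)]
    by (auto simp: clopenin_def closedin_def)
qed

lemma clopenin_Int_above:
  assumes "clopenin T U" "x \<in> X - U"
  shows "clopenin T (U \<inter> above x)"
  using continuous_tournament.clopenin_Int_below[OF dual_continuous_tournament assms]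
  unfolding above_def continuous_tournament.below_def[OF dual_continuous_tournament] .

text \<open>A point outside a quasi-component lies on the same side of all its points: a clopen set around
  \<open>x\<close> that misses \<open>z\<close> has clopen traces on the two rays of \<open>z\<close>, and these cannot
  divide the quasi-component.\<close>

lemma outside_quasi_component_below:
  assumes "quasi_component_of T x y" "z \<in> X" "\<not> quasi_component_of T x z" "x \<sqsubset> z"
  shows "y \<sqsubset> z"
proof -
  have x: "x \<in> X"
    using assms(1) by (simp add: quasi_component_of_def)
  obtain U where U: "clopenin T U" "x \<in> U" "z \<notin> U"
    using quasi_component_separation[OF x assms(2,3)] .
  then have "y \<in> U \<inter> below z"
    using assms x by (intro quasi_component_in_clopen[OF assms(1) clopenin_Int_below]) (auto simp: below_def)
  then show ?thesis
    by (simp add: below_def)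
qed

lemma outside_quasi_component_above:
  assumes "quasi_component_of T x y" "z \<in> X" "\<not> quasi_component_of T x z" "z \<sqsubset> x"
  shows "z \<sqsubset> y"
  using continuous_tournament.outside_quasi_component_below[OF dual_continuous_tournament assms] .

text \<open>On a quasi-component the tournament is a linear order, because a three-cycle would cut it.\<close>

lemma quasi_component_trans:
  assumes abc: "a \<sqsubset> b" "b \<sqsubset> c" and q: "quasi_component_of T a b" "quasi_component_of T a c"
  shows "a \<sqsubset> c"
proof (rule ccontr)
  assume neg: "\<not> a \<sqsubset> c"
  have X: "a \<in> X" "b \<in> X" "c \<in> X"
    using q by (auto simp: quasi_component_of_def)
  have "c \<noteq> a"
    using abc X asym by blast
  then have ca: "c \<sqsubset> a"
    using neg X total by blast
  \<comment> \<open>The open interval from \<open>b\<close> to \<open>a\<close> agrees with the closed one because \<open>a\<close> precedes \<open>b\<close>.\<close>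
  have "\<not> (b \<sqsubset> w \<and> w \<sqsubset> a) \<longleftrightarrow> w \<sqsubset> b \<or> a \<sqsubset> w" if "w \<in> X" for w
    using X abc(1) total[of w a] total[of w b] asym[of w a] asym[of w b] asym[of a b] that
    by (cases "w = a \<or> w = b") (use asym in metis)+
  then have eq: "X - above b \<inter> below a = below b \<union> above a"
    by (auto simp: below_def above_def)
  have "openin T (X - above b \<inter> below a)"
    unfolding eq using X by (simp add: openin_above openin_below openin_Un)
  then have "clopenin T (above b \<inter> below a)"
    using X by (auto simp: clopenin_def closedin_def openin_above openin_below openin_Int) (auto simp: above_def)
  moreover have "c \<in> above b \<inter> below a"
    using X abc ca by (auto simp: below_def above_def)
  ultimately have "a \<in> above b \<inter> below a"
    using quasi_component_in_clopen[of T c a] q(2) quasi_component_of_sym[of T a c] by blast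
  then show False
    using X irrefl by (simp add: below_def)
qed

end

text \<open>The situation of the theorem, for the strict relation of the given continuous weak selection. All
  assumptions are symmetric under reversal of that relation, so every result below has a dual.\<close>

locale quasi_king_tournament = continuous_tournament +
  assumes topology_of_rays: "T = topology_generated_by
      (insert (topspace T) ({{y \<in> topspace T. y \<sqsubset> x} |x. x \<in> topspace T} \<union>
        {{y \<in> topspace T. x \<sqsubset> y} |x. x \<in> topspace T}))"
    and has_quasi_king: "open_tournament T R \<Longrightarrow>
      \<exists>q \<in> topspace T. \<forall>x \<in> topspace T.
        (\<lambda>u v. u \<in> topspace T \<and> v \<in> topspace T \<and> R u v)\<^sup>*\<^sup>* x q"
begin

lemma dual_quasi_king_tournament: "quasi_king_tournament T (\<lambda>x y. y \<sqsubset> x)"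
proof -
  interpret dual: continuous_tournament T "\<lambda>x y. y \<sqsubset> x"
    by (rule dual_continuous_tournament)
  show ?thesis
    by unfold_locales (use topology_of_rays has_quasi_king in \<open>simp_all add: Un_commute\<close>)
qed

section \<open>Locally constant ranks\<close>

text \<open>Compare points first by a locally constant rank and then by the given relation. The rays stay open.
  The rank cannot decrease along a chain of this new tournament, so its quasi-king has the largest rank, and
  chains from points of that rank never leave their level.\<close>

lemma rank_quasi_king:
  fixes r :: "'a \<Rightarrow> nat"
  assumes r: "\<And>n. clopenin T {x \<in> X. r x = n}"
  obtains q where "q \<in> X" "\<And>x. x \<in> X \<Longrightarrow> r x \<le> r q"
    "\<And>x. \<lbrakk>x \<in> X; r x = r q\<rbrakk> \<Longrightarrow>
      (\<lambda>u v. (u \<in> X \<and> r u = r q) \<and> (v \<in> X \<and> r v = r q) \<and> u \<sqsubset> v)\<^sup>*\<^sup>* x q"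
proof -
  define R where "R x y \<longleftrightarrow> r x < r y \<or> r x = r y \<and> x \<sqsubset> y" for x y
  have level: "openin T {y \<in> X. r y \<in> N}" for N
  proof -
    have "{y \<in> X. r y \<in> N} = (\<Union>n\<in>N. {y \<in> X. r y = n})"
      by auto
    then show ?thesis
      using r by (auto simp: clopenin_def)
  qed
  have "openin T {y \<in> X. R y x}" "openin T {y \<in> X. R x y}" if "x \<in> X" for x
  proof -
    have "{y \<in> X. R y x} = {y \<in> X. r y \<in> {..<r x}} \<union> {y \<in> X. r y \<in> {r x}} \<inter> below x"
      "{y \<in> X. R x y} = {y \<in> X. r y \<in> {r x<..}} \<union> {y \<in> X. r y \<in> {r x}} \<inter> above x"
      by (auto simp: R_def below_def above_def)
    then show "openin T {y \<in> X. R y x}" "openin T {y \<in> X. R x y}"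
      by (simp_all only: openin_Un openin_Int level openin_below[OF that] openin_above[OF that])
  qed
  moreover have "x \<noteq> y \<Longrightarrow> R x y \<or> R y x" "R x y \<Longrightarrow> \<not> R y x" if "x \<in> X" "y \<in> X" for x y
    using total[OF that] asym[OF that] unfolding R_def by linarith+
  ultimately have "open_tournament T R"
    unfolding open_tournament_def by blast
  then obtain q where q: "q \<in> X" "\<And>x. x \<in> X \<Longrightarrow> (\<lambda>u v. u \<in> X \<and> v \<in> X \<and> R u v)\<^sup>*\<^sup>* x q"
    using has_quasi_king by blast
  let ?S = "\<lambda>u v. (u \<in> X \<and> r u = r q) \<and> (v \<in> X \<and> r v = r q) \<and> u \<sqsubset> v"
  have "r x \<le> r q \<and> (r x = r q \<longrightarrow> ?S\<^sup>*\<^sup>* x q)" if "x \<in> X" for x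
    using q(2)[OF that]
  proof (induction rule: converse_rtranclp_induct)
    case (step u v)
    then have "r u \<le> r v" and "r u = r q \<Longrightarrow> ?S u v"
      by (auto simp: R_def)
    then show ?case
      using step converse_rtranclp_into_rtranclp[of ?S u v q] by fastforce
  qed simp
  then show thesis
    using that[of q] q(1) by blast
qed

corollary locally_constant_rank_bounded:
  assumes "\<And>n. clopenin T {x \<in> X. r x = (n::nat)}"
  obtains N where "\<And>x. x \<in> X \<Longrightarrow> r x \<le> N"
  by (rule rank_quasi_king[OF assms]) (rule that)

text \<open>The characteristic function of \<open>A\<close> is a rank.\<close>

corollary clopen_quasi_king:
  assumes A: "clopenin T A" "A \<noteq> {}"
  obtains q where "q \<in> A" "\<And>x. x \<in> A \<Longrightarrow> (\<lambda>u v. u \<in> A \<and> v \<in> A \<and> u \<sqsubset> v)\<^sup>*\<^sup>* x q"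
proof -
  define r where "r x = (if x \<in> A then 1 else 0::nat)" for x
  have AX: "A \<subseteq> X"
    using A(1) by (rule clopenin_subset)
  have "{x \<in> X. r x = n} = (if n = 1 then A else if n = 0 then X - A else {})" for n
    using AX by (auto simp: r_def)
  then have "clopenin T {x \<in> X. r x = n}" for n
    using A by (simp add: clopenin_Diff)
  then obtain q where q: "q \<in> X" "\<And>x. x \<in> X \<Longrightarrow> r x \<le> r q" "\<And>x. \<lbrakk>x \<in> X; r x = r q\<rbrakk> \<Longrightarrow>
      (\<lambda>u v. (u \<in> X \<and> r u = r q) \<and> (v \<in> X \<and> r v = r q) \<and> u \<sqsubset> v)\<^sup>*\<^sup>* x q"
    using rank_quasi_king by blast
  obtain a where a: "a \<in> A"
    using A(2) by blast
  then have "r q = 1"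
    using q(2)[of a] AX by (auto simp: r_def split: if_splits)
  then have iff: "u \<in> X \<and> r u = r q \<longleftrightarrow> u \<in> A" for u
    using AX by (auto simp: r_def split: if_splits)
  show thesis
  proof (rule that)
    show "q \<in> A"
      using q(1) iff[of q] by blast
    show "(\<lambda>u v. u \<in> A \<and> v \<in> A \<and> u \<sqsubset> v)\<^sup>*\<^sup>* x q" if "x \<in> A" for x
      using q(3)[of x, unfolded iff] that iff[of x] by blast
  qed
qed

text \<open>The first index at which a point has left the sequence is a rank.\<close>

corollary decreasing_clopens_eventually_empty:
  assumes C: "\<And>n. clopenin T (C n)" "decseq C" "(\<Inter>n. C n) = {}"
  shows "\<exists>n. C n = {}"
proof -
  have ex: "\<exists>n. x \<notin> C n" for x
    using C(3) by blast
  define r where "r x = (LEAST n. x \<notin> C n)" for x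
  have notin: "x \<notin> C n \<longleftrightarrow> r x \<le> n" for x n
  proof
    assume "r x \<le> n"
    then show "x \<notin> C n"
      using LeastI_ex[OF ex, of x] decseqD[OF C(2)] unfolding r_def by blast
  qed (simp add: r_def Least_le)
  have "clopenin T {x \<in> X. r x = n}" for n
  proof (cases n)
    case 0
    then have "{x \<in> X. r x = n} = X - C 0"
      using notin[of _ 0] by auto
    then show ?thesis
      using C(1) by (simp add: clopenin_Diff)
  next
    case (Suc m)
    then have "{x \<in> X. r x = n} = C m - C n"
      using notin[of _ m] notin[of _ n] clopenin_subset[OF C(1)] by force
    then show ?thesis
      using C(1) by (simp add: clopenin_Diff)
  qed
  then obtain N where N: "\<And>x. x \<in> X \<Longrightarrow> r x \<le> N"
    using locally_constant_rank_bounded by blast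
  then have "C N = {}"
    using notin clopenin_subset[OF C(1)] by blast
  then show ?thesis ..
qed

text \<open>If each point had a clopen neighbourhood meeting only finitely many of the sets, their union would be
  clopen, and the index of the set containing a point would be an unbounded rank.\<close>

corollary disjoint_clopens_cluster:
  assumes U: "\<And>n::nat. clopenin T (U n)" "\<And>n. U n \<noteq> {}" "disjoint_family U"
  obtains x where "x \<in> X" "\<And>W. clopenin T W \<Longrightarrow> x \<in> W \<Longrightarrow> infinite {n. U n \<inter> W \<noteq> {}}"
proof (rule ccontr)
  note thesis_if = that
  assume "\<not> thesis"
  then have W: "\<exists>W. clopenin T W \<and> x \<in> W \<and> finite {n. U n \<inter> W \<noteq> {}}" if "x \<in> X" for x
    using that thesis_if by blast
  define r where "r x = (if x \<in> (\<Union>n. U n) then Suc (THE n. x \<in> U n) else 0)" for x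
  have r_Suc: "r x = Suc n" if "x \<in> U n" for x n
  proof -
    have "(THE n. x \<in> U n) = n"
      using that U(3) by (intro the_equality) (auto simp: disjoint_family_on_def)
    then show ?thesis
      using that by (auto simp: r_def)
  qed
  have Suc_iff: "r x = Suc n \<longleftrightarrow> x \<in> U n" for x n
    using r_Suc by (metis UN_E nat.distinct(1) nat.inject r_def)
  have zero_iff: "r x = 0 \<longleftrightarrow> x \<notin> (\<Union>n. U n)" for x
    by (simp add: r_def)
  have "clopenin T {x \<in> X. r x = n}" for n
  proof (cases n)
    case 0
    have "clopenin T (X - (\<Union>n. U n))"
    proof (rule clopeninI_local)
      fix x assume x: "x \<in> X - (\<Union>n. U n)"
      then obtain W where "clopenin T W" "x \<in> W" and fin: "finite {n. U n \<inter> W \<noteq> {}}"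
        using W[of x] by blast
      then have "clopenin T (W - \<Union>(U ` {n. U n \<inter> W \<noteq> {}}))"
        using U(1) by (intro clopenin_Diff clopenin_Union) auto
      then show "\<exists>V. openin T V \<and> x \<in> V \<and> V \<subseteq> X - (\<Union>n. U n)"
        using x \<open>x \<in> W\<close> clopenin_subset[OF \<open>clopenin T W\<close>]
        by (intro exI[of _ "W - \<Union>(U ` {n. U n \<inter> W \<noteq> {}})"]) (auto simp: clopenin_def)
    next
      fix x assume "x \<in> X - (X - (\<Union>n. U n))"
      then show "\<exists>V. openin T V \<and> x \<in> V \<and> V \<inter> (X - (\<Union>n. U n)) = {}"
        using U(1) by (auto simp: clopenin_def)
    qed auto
    moreover have "{x \<in> X. r x = n} = X - (\<Union>n. U n)"
      using 0 zero_iff by auto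
    ultimately show ?thesis
      by simp
  next
    case (Suc m)
    then have "{x \<in> X. r x = n} = U m"
      using Suc_iff clopenin_subset[OF U(1)] by auto
    then show ?thesis
      using U(1) by simp
  qed
  then obtain N where N: "\<And>x. x \<in> X \<Longrightarrow> r x \<le> N"
    using locally_constant_rank_bounded by blast
  obtain x where "x \<in> U N"
    using U(2) by blast
  then show False
    using N[of x] r_Suc clopenin_subset[OF U(1)] by fastforce
qed

section \<open>Quasi-components\<close>

text \<open>Otherwise the set \<open>H\<close> of points above the whole quasi-component \<open>Q\<close> is clopen: it
  does not accumulate at \<open>Q\<close>, since each point of \<open>Q\<close> lies below another one, and
  near points outside \<open>Q\<close> it agrees with the open ray above \<open>x\<close>. From
  \<open>Q\<close> one can climb inside \<open>X - H\<close> only within \<open>Q\<close>, where the order is linear and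
  has no largest element, so \<open>X - H\<close> has no quasi-king.\<close>

lemma quasi_component_has_max:
  assumes "x \<in> X"
  obtains b where "quasi_component_of T x b"
    "\<And>y. quasi_component_of T x y \<Longrightarrow> y = b \<or> y \<sqsubset> b"
proof (rule ccontr)
  note thesis_if = that
  assume "\<not> thesis"
  then have no_max: "\<exists>y. quasi_component_of T x y \<and> b \<sqsubset> y" if "quasi_component_of T x b" for b
    using that total thesis_if[OF that] unfolding quasi_component_of_def by blast
  let ?Q = "quasi_component_of_set T x"
  have QX: "?Q \<subseteq> X"
    by (rule quasi_component_of_subset_topspace)
  define H where "H = {w \<in> X. \<forall>q\<in>?Q. q \<sqsubset> w}"
  have side: "w \<in> H" if "w \<in> X" "w \<notin> ?Q" "y \<in> ?Q" "y \<sqsubset> w" for w y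
  proof -
    have "x \<sqsubset> w" 
      using that outside_quasi_component_below[of y x w] quasi_component_of_sym[of T] quasi_component_of_trans[of T]
      by (metis mem_Collect_eq)
    then show ?thesis
      using that outside_quasi_component_below[of x _ w] by (auto simp: H_def)
  qed
  have disj: "H \<inter> ?Q = {}"
    using irrefl by (auto simp: H_def)
  have "clopenin T (X - H)"
  proof (rule clopeninI_local)
    fix w assume w: "w \<in> X - H"
    then obtain q where "q \<in> ?Q" "\<not> q \<sqsubset> w"
      by (auto simp: H_def)
    then obtain q' where "q' \<in> ?Q" "w \<sqsubset> q'"
      using no_max w total[of w q] QX by blast
    moreover have "below q' \<subseteq> X - H"
      using \<open>q' \<in> ?Q\<close> QX asym by (auto simp: below_def H_def)
    ultimately show "\<exists>U. openin T U \<and> w \<in> U \<and> U \<subseteq> X - H"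
      using w QX openin_below[of q'] by (intro exI[of _ "below q'"]) (auto simp: below_def)
  next
    fix w assume "w \<in> X - (X - H)"
    then have w: "w \<in> X" "w \<in> H" by auto
    obtain U where U: "clopenin T U" "w \<in> U" "x \<notin> U"
      using w disj assms quasi_component_separation[of w T x] quasi_component_of_sym[of T] by blast
    have "U \<inter> above x \<subseteq> H"
    proof
      fix v assume v: "v \<in> U \<inter> above x"
      then have "v \<notin> ?Q"
        using U quasi_component_in_clopen[of T v x U] quasi_component_of_sym[of T x v] by blast
      then show "v \<in> H"
        using side[of v x] v assms by (auto simp: above_def)
    qed
    moreover have "w \<in> above x"
      using w assms by (auto simp: H_def above_def)
    ultimately show "\<exists>V. openin T V \<and> w \<in> V \<and> V \<inter> (X - H) = {}"
      using U assms openin_above[of x]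
      by (intro exI[of _ "U \<inter> above x"]) (auto simp: clopenin_def)
  qed auto
  moreover have "x \<in> X - H"
    using disj assms by auto
  ultimately obtain k where k: "k \<in> X - H"
    and king: "\<And>y. y \<in> X - H \<Longrightarrow> (\<lambda>u v. u \<in> X - H \<and> v \<in> X - H \<and> u \<sqsubset> v)\<^sup>*\<^sup>* y k"
    using clopen_quasi_king[of "X - H"] by blast
  have up: "v \<in> ?Q" if "u \<in> ?Q" "v \<in> X - H" "u \<sqsubset> v" for u v
    using side[of v u] that by blast
  have climb: "k \<in> ?Q \<and> (k = y \<or> y \<sqsubset> k)" if "y \<in> ?Q" for y
  proof -
    have "y \<in> X - H"
      using that disj QX by blast
    from king[OF this] show ?thesis
    proof (induction rule: rtranclp_induct)
      case (step u v)
      then have "v \<in> ?Q"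
        using up by blast
      moreover have "y = u \<or> y \<sqsubset> u \<Longrightarrow> y = v \<or> y \<sqsubset> v"
        using step quasi_component_trans[of y u v] that \<open>v \<in> ?Q\<close>
          quasi_component_of_sym[of T] quasi_component_of_trans[of T]
        by (metis mem_Collect_eq)
      ultimately show ?case
        using step by blast
    qed (use that in simp)
  qed
  have "k \<in> ?Q"
    using climb[of x] assms by simp
  then obtain y where y: "y \<in> ?Q" "k \<sqsubset> y"
    using no_max by blast
  then show False
    using climb[of y] asym[of k y] irrefl[of k] QX by blast
qed

lemma quasi_component_has_min:
  assumes "x \<in> X"
  obtains a where "quasi_component_of T x a"
    "\<And>y. quasi_component_of T x y \<Longrightarrow> y = a \<or> a \<sqsubset> y"
  by (rule quasi_king_tournament.quasi_component_has_max[OF dual_quasi_king_tournament assms]) (rule that)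

section \<open>Separating quasi-components by ordered clopen sets\<close>

text \<open>On its upper side, the maximum \<open>b\<close> of a quasi-component has arbitrarily small clopen
  neighbourhoods. For a ray bounded by a point of another quasi-component this is the clopen trace of
  the ray. A ray bounded from below by a point of the same quasi-component contains everything above
  \<open>b\<close>.\<close>

lemma clopen_above_max:
  assumes b: "b \<in> X" "\<And>y. quasi_component_of T b y \<Longrightarrow> y = b \<or> y \<sqsubset> b"
    and G: "openin T G" "b \<in> G"
  shows "\<exists>W. clopenin T W \<and> b \<in> W \<and> (\<forall>w\<in>W. b \<sqsubset> w \<longrightarrow> w \<in> G)"
proof -
  have "generate_topology_on (insert X ({{y \<in> X. y \<sqsubset> x} |x. x \<in> X} \<union>
        {{y \<in> X. x \<sqsubset> y} |x. x \<in> X})) G"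
    using G(1) by (subst (asm) topology_of_rays) (rule openin_topology_generated_by)
  then show ?thesis
    using G(2)
  proof induction
    case (Int G H)
    then obtain W W' where "clopenin T W" "b \<in> W" "\<forall>w\<in>W. b \<sqsubset> w \<longrightarrow> w \<in> G"
      "clopenin T W'" "b \<in> W'" "\<forall>w\<in>W'. b \<sqsubset> w \<longrightarrow> w \<in> H"
      by blast
    then show ?case
      by (intro exI[of _ "W \<inter> W'"]) (auto intro: clopenin_Int)
  next
    case (UN K)
    then obtain k where "k \<in> K" "b \<in> k"
      by blast
    then show ?case
      using UN.IH[of k] by blast
  next
    case (Basis G)
    then consider "G = X" | y where "y \<in> X" "G = below y" | y where "y \<in> X" "G = above y"
      by (auto simp: below_def above_def)
    then show ?case
    proof cases
      case 1
      then show ?thesis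
        using b by (intro exI[of _ X]) (auto dest: clopenin_subset)
    next
      case 2
      then have b_less: "b \<sqsubset> y"
        using Basis by (simp add: below_def)
      then have "\<not> quasi_component_of T b y"
        using b asym[of b y] irrefl[of b] 2 by blast
      then obtain W where W: "clopenin T W" "b \<in> W" "y \<notin> W"
        using quasi_component_separation[OF b(1) 2(1)] by blast
      then show ?thesis
        using 2 b_less b clopenin_Int_below[of W y]
        by (intro exI[of _ "W \<inter> below y"]) (auto simp: below_def)
    next
      case 3
      then have yb: "y \<sqsubset> b"
        using Basis by (simp add: above_def)
      show ?thesis
      proof (cases "quasi_component_of T b y")
        case True
        have "y \<sqsubset> w" if "w \<in> X" "b \<sqsubset> w" for w
          using outside_quasi_component_below[OF True that(1) _ that(2)] b(2)[of w]
            asym[OF b(1) that] irrefl[OF b(1)] that by blast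
        then show ?thesis
          using 3 b by (intro exI[of _ X]) (auto simp: above_def)
      next
        case False
        then obtain W where W: "clopenin T W" "b \<in> W" "y \<notin> W"
          using quasi_component_separation[OF b(1) 3(1)] by blast
        then show ?thesis
          using 3 yb b clopenin_Int_above[of W y]
          by (intro exI[of _ "W \<inter> above y"]) (auto simp: above_def)
      qed
    qed
  qed simp
qed

lemma clopen_below_min:
  assumes "a \<in> X" "\<And>y. quasi_component_of T a y \<Longrightarrow> y = a \<or> a \<sqsubset> y"
    and "openin T G" "a \<in> G"
  shows "\<exists>W. clopenin T W \<and> a \<in> W \<and> (\<forall>w\<in>W. w \<sqsubset> a \<longrightarrow> w \<in> G)"
  using assms by (rule quasi_king_tournament.clopen_above_max[OF dual_quasi_king_tournament])

text \<open>Neighbourhoods of the minimum \<open>a\<close> and of the maximum \<open>b\<close> already control a clopen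
  neighbourhood of the quasi-component, up to the quasi-component itself. This replaces a compactness argument
  for quasi-components.\<close>

lemma clopen_around_quasi_component:
  assumes x: "x \<in> X"
  obtains a b where "quasi_component_of T x a" "quasi_component_of T x b"
    "\<And>G H. \<lbrakk>openin T G; a \<in> G; openin T H; b \<in> H\<rbrakk> \<Longrightarrow>
      \<exists>W. clopenin T W \<and> x \<in> W \<and> W \<subseteq> G \<union> quasi_component_of_set T x \<union> H"
proof -
  obtain b where b: "quasi_component_of T x b" "\<And>y. quasi_component_of T x y \<Longrightarrow> y = b \<or> y \<sqsubset> b"
    using quasi_component_has_max[OF x] by blast
  obtain a where a: "quasi_component_of T x a" "\<And>y. quasi_component_of T x y \<Longrightarrow> y = a \<or> a \<sqsubset> y"
    using quasi_component_has_min[OF x] by blast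
  have abX: "a \<in> X" "b \<in> X"
    using a b by (auto simp: quasi_component_of_def)
  have bmax: "y = b \<or> y \<sqsubset> b" if "quasi_component_of T b y" for y
    using b(2) quasi_component_of_trans[OF b(1) that] .
  have amin: "y = a \<or> a \<sqsubset> y" if "quasi_component_of T a y" for y
    using a(2) quasi_component_of_trans[OF a(1) that] .
  show thesis
  proof (rule that[OF a(1) b(1)])
    fix G H assume G: "openin T G" "a \<in> G" and H: "openin T H" "b \<in> H"
    obtain V where V: "clopenin T V" "b \<in> V" "\<forall>w\<in>V. b \<sqsubset> w \<longrightarrow> w \<in> H"
      using clopen_above_max[OF abX(2) bmax H] by blast
    obtain W where W: "clopenin T W" "a \<in> W" "\<forall>w\<in>W. w \<sqsubset> a \<longrightarrow> w \<in> G"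
      using clopen_below_min[OF abX(1) amin G] by blast
    have "x \<in> V" "x \<in> W"
      using quasi_component_in_clopen[OF _ V(1,2)] quasi_component_in_clopen[OF _ W(1,2)]
        a(1) b(1) quasi_component_of_sym[of T x] by simp_all
    moreover have "w \<in> G \<union> quasi_component_of_set T x \<union> H" if w: "w \<in> V \<inter> W" for w
    proof (cases "quasi_component_of T x w")
      case False
      have wX: "w \<in> X"
        using w clopenin_subset[OF V(1)] by blast
      then have "x \<sqsubset> w \<or> w \<sqsubset> x"
        using total[OF x wX] False x by (cases "x = w") auto
      then have "b \<sqsubset> w \<or> w \<sqsubset> a"
        using outside_quasi_component_below[OF b(1) wX False]
          outside_quasi_component_above[OF a(1) wX False] by blast
      then show ?thesis
        using V W w by blast
    qed simp
    ultimately show "\<exists>W. clopenin T W \<and> x \<in> W \<and> W \<subseteq> G \<union> quasi_component_of_set T x \<union> H"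
      using V W by (intro exI[of _ "V \<inter> W"]) (auto intro: clopenin_Int)
  qed
qed

text \<open>Points of \<open>W\<close> near the endpoints \<open>a\<close> and \<open>b\<close> are handled by continuity at
  \<open>(a, z)\<close> and \<open>(b, z)\<close>; points of the quasi-component of \<open>x\<close> lie below all of
  \<open>V\<close> because \<open>V\<close> lies above \<open>x\<close> and outside the quasi-component.\<close>

lemma clopen_below_open:
  assumes x: "x \<in> X" and z: "z \<in> X" and xz: "\<not> quasi_component_of T x z" "x \<sqsubset> z"
  shows "\<exists>U V. clopenin T U \<and> openin T V \<and> x \<in> U \<and> z \<in> V \<and> (\<forall>s\<in>U. \<forall>t\<in>V. s \<sqsubset> t)"
proof -
  obtain a b where ab: "quasi_component_of T x a" "quasi_component_of T x b"
    and around: "\<And>G H. \<lbrakk>openin T G; a \<in> G; openin T H; b \<in> H\<rbrakk> \<Longrightarrow>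
      \<exists>W. clopenin T W \<and> x \<in> W \<and> W \<subseteq> G \<union> quasi_component_of_set T x \<union> H"
    using clopen_around_quasi_component[OF x] by blast
  have abX: "a \<in> X" "b \<in> X"
    using ab by (auto simp: quasi_component_of_def)
  have less: "a \<sqsubset> z" "b \<sqsubset> z"
    using outside_quasi_component_below[OF _ z xz] ab by simp_all
  obtain G A where G: "openin T G" "a \<in> G" "openin T A" "z \<in> A" "\<forall>s\<in>G. \<forall>t\<in>A. s \<sqsubset> t"
    using cont[OF abX(1) z less(1)] by blast
  obtain H B where H: "openin T H" "b \<in> H" "openin T B" "z \<in> B" "\<forall>s\<in>H. \<forall>t\<in>B. s \<sqsubset> t"
    using cont[OF abX(2) z less(2)] by blast
  obtain W where W: "clopenin T W" "x \<in> W" "W \<subseteq> G \<union> quasi_component_of_set T x \<union> H"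
    using around[OF G(1,2) H(1,2)] by blast
  obtain Z where Z: "clopenin T Z" "x \<in> Z" "z \<notin> Z"
    using quasi_component_separation[OF x z xz(1)] .
  define V where "V = A \<inter> B \<inter> ((X - Z) \<inter> above x)"
  have "openin T V"
    using G H Z x by (auto simp: V_def clopenin_def intro!: openin_Int openin_diff openin_above)
  moreover have "s \<sqsubset> t" if s: "s \<in> W" and t: "t \<in> V" for s t
  proof (cases "quasi_component_of T x s")
    case True
    have t': "t \<in> X" "x \<sqsubset> t" "t \<notin> Z"
      using t by (auto simp: V_def above_def)
    have "\<not> quasi_component_of T x t"
      using quasi_component_in_clopen[of T x t Z] Z t' by blast
    then show ?thesis
      using outside_quasi_component_below[OF True] t' by blast
  next
    case False
    then show ?thesis
      using W(3) s t G(5) H(5) by (auto simp: V_def)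
  qed
  moreover have "z \<in> V"
    using G H Z z xz by (auto simp: V_def above_def)
  ultimately show ?thesis
    using W by blast
qed

text \<open>The same argument around the quasi-component of \<open>z\<close>, with the preceding lemma in the place of
  continuity. In terms of clopen sets the tournament is now continuous on the space of
  quasi-components.\<close>

lemma clopen_below_clopen:
  assumes x: "x \<in> X" and z: "z \<in> X" and xz: "\<not> quasi_component_of T x z" "x \<sqsubset> z"
  shows "\<exists>U V. clopenin T U \<and> clopenin T V \<and> x \<in> U \<and> z \<in> V \<and> (\<forall>s\<in>U. \<forall>t\<in>V. s \<sqsubset> t)"
proof -
  have zx: "\<not> quasi_component_of T z x"
    using xz(1) quasi_component_of_sym[of T x z] by blast
  obtain a b where ab: "quasi_component_of T z a" "quasi_component_of T z b"
    and around: "\<And>G H. \<lbrakk>openin T G; a \<in> G; openin T H; b \<in> H\<rbrakk> \<Longrightarrow>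
      \<exists>W. clopenin T W \<and> z \<in> W \<and> W \<subseteq> G \<union> quasi_component_of_set T z \<union> H"
    using clopen_around_quasi_component[OF z] by blast
  have right: "y \<in> X \<and> \<not> quasi_component_of T x y \<and> x \<sqsubset> y" if "quasi_component_of T z y" for y
    using outside_quasi_component_above[OF that x zx xz(2)] that xz(1)
      quasi_component_of_trans[of T x y z] quasi_component_of_sym[of T z y]
    by (auto simp: quasi_component_of_def)
  obtain G A where G: "openin T G" "a \<in> G" "clopenin T A" "x \<in> A" "\<forall>s\<in>A. \<forall>t\<in>G. s \<sqsubset> t"
    using clopen_below_open[OF x, of a] right[OF ab(1)] by blast
  obtain H B where H: "openin T H" "b \<in> H" "clopenin T B" "x \<in> B" "\<forall>s\<in>B. \<forall>t\<in>H. s \<sqsubset> t"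
    using clopen_below_open[OF x, of b] right[OF ab(2)] by blast
  obtain W where W: "clopenin T W" "z \<in> W" "W \<subseteq> G \<union> quasi_component_of_set T z \<union> H"
    using around[OF G(1,2) H(1,2)] by blast
  obtain Z where Z: "clopenin T Z" "z \<in> Z" "x \<notin> Z"
    using quasi_component_separation[OF z x zx] .
  define U where "U = A \<inter> B \<inter> ((X - Z) \<inter> below z)"
  have "clopenin T U"
    using G H Z z by (auto simp: U_def intro!: clopenin_Int[OF clopenin_Int] clopenin_Int_below clopenin_Diff)
  moreover have "s \<sqsubset> t" if s: "s \<in> U" and t: "t \<in> W" for s t
  proof (cases "quasi_component_of T z t")
    case True
    have s': "s \<in> X" "s \<sqsubset> z" "s \<notin> Z"
      using s by (auto simp: U_def below_def)
    have "\<not> quasi_component_of T z s"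
      using quasi_component_in_clopen[of T z s Z] Z s' by blast
    then show ?thesis
      using outside_quasi_component_above[OF True] s' by blast
  next
    case False
    then show ?thesis
      using W(3) s t G(5) H(5) by (auto simp: U_def)
  qed
  moreover have "x \<in> U"
    using G H Z x xz by (auto simp: U_def below_def)
  ultimately show ?thesis
    using W by blast
qed

lemma clopen_order_constant:
  assumes A: "clopenin T A" "x \<in> A" "z \<in> X - A"
  obtains U V where "clopenin T U" "clopenin T V" "x \<in> U" "z \<in> V"
    "(\<forall>s\<in>U. \<forall>t\<in>V. s \<sqsubset> t) \<or> (\<forall>s\<in>U. \<forall>t\<in>V. t \<sqsubset> s)"
proof -
  have xX: "x \<in> X"
    using A clopenin_subset by blast
  have "\<not> quasi_component_of T x z"
    using A quasi_component_in_clopen[of T x z A] by blast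
  moreover have "\<not> quasi_component_of T z x"
    using calculation quasi_component_of_sym[of T x z] by blast
  moreover have "x \<sqsubset> z \<or> z \<sqsubset> x"
    using A xX total[of x z] by blast
  ultimately show thesis
    using clopen_below_clopen[of x z] clopen_below_clopen[of z x] that xX A(3) by blast
qed

section \<open>Convergent subsequences\<close>

text \<open>A cluster point of an ascending sequence is unique up to clopen sets: if \<open>x\<close> and \<open>y\<close>
  had clopen neighbourhoods \<open>G\<close> and \<open>H\<close>, one entirely below the other, then the sequence would have to
  visit \<open>H\<close>, \<open>G\<close> and \<open>H\<close> in this order while ascending. If the sequence did not
  converge to \<open>x\<close>, the parts of its members outside a neighbourhood of \<open>x\<close> would
  provide such a \<open>y\<close>.\<close>

lemma ascending_clopens_converge:
  fixes V :: "nat \<Rightarrow> 'a set"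
  assumes V: "\<And>k. clopenin T (V k)" "\<And>k. V k \<noteq> {}"
    and asc: "\<And>i k s t. \<lbrakk>i < k; s \<in> V i; t \<in> V k\<rbrakk> \<Longrightarrow> s \<sqsubset> t"
  obtains x where "x \<in> X" "\<And>W. clopenin T W \<Longrightarrow> x \<in> W \<Longrightarrow> \<forall>\<^sub>F k in sequentially. V k \<subseteq> W"
proof -
  have VX: "V k \<subseteq> X" for k
    using V(1) by (rule clopenin_subset)
  have disj: "V i \<inter> V k = {}" if "i \<noteq> k" for i k
    using that asc[of i k] asc[of k i] irrefl VX by (metis disjoint_iff linorder_neqE_nat subsetD)
  then have "disjoint_family V"
    by (simp add: disjoint_family_on_def)
  then obtain x where x: "x \<in> X"
    and cl: "\<And>W. clopenin T W \<Longrightarrow> x \<in> W \<Longrightarrow> infinite {k. V k \<inter> W \<noteq> {}}"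
    using disjoint_clopens_cluster[of V, OF V] by blast
  show thesis
  proof (rule that[OF x], rule ccontr)
    fix W assume W: "clopenin T W" "x \<in> W" "\<not> (\<forall>\<^sub>F k in sequentially. V k \<subseteq> W)"
    define K where "K = {k. \<not> V k \<subseteq> W}"
    have "infinite K"
      using W(3) eventually_cofinite[of "\<lambda>k. V k \<subseteq> W"]
      unfolding K_def cofinite_eq_sequentially by blast
    define e where "e = enumerate K"
    have e: "strict_mono e" "e j \<in> K" for j
      using \<open>infinite K\<close> by (auto simp: e_def strict_mono_enumerate enumerate_in_set)
    have pieces: "clopenin T (V (e j) - W)" "V (e j) - W \<noteq> {}" for j
      using e(2)[of j] V(1) W(1) by (auto simp: K_def clopenin_Diff)
    have "disjoint_family (\<lambda>j. V (e j) - W)"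
    proof (unfold disjoint_family_on_def, intro ballI impI)
      fix i j :: nat assume "i \<noteq> j"
      then show "(V (e i) - W) \<inter> (V (e j) - W) = {}"
        using disj[of "e i" "e j"] strict_mono_eq[OF e(1), of i j] by blast
    qed
    then obtain y where y: "y \<in> X"
      and cl': "\<And>Z. clopenin T Z \<Longrightarrow> y \<in> Z \<Longrightarrow> infinite {j. (V (e j) - W) \<inter> Z \<noteq> {}}"
      using disjoint_clopens_cluster[of "\<lambda>j. V (e j) - W", OF pieces] by blast
    have "y \<notin> W"
    proof
      assume "y \<in> W"
      then have "infinite {j. (V (e j) - W) \<inter> W \<noteq> {}}"
        by (rule cl'[OF W(1)])
      moreover have "(V (e j) - W) \<inter> W = {}" for j
        by blast
      ultimately show False
        by simp
    qed
    then obtain G H where GH: "clopenin T G" "clopenin T H" "x \<in> G" "y \<in> H"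
      "(\<forall>s\<in>G. \<forall>t\<in>H. s \<sqsubset> t) \<or> (\<forall>s\<in>G. \<forall>t\<in>H. t \<sqsubset> s)"
      using clopen_order_constant[OF W(1,2)] y by blast
    have G: "\<exists>k>N. \<exists>s. s \<in> V k \<inter> G" and H: "\<exists>k>N. \<exists>t. t \<in> V (e k) \<inter> H" for N
      using cl[OF GH(1,3)] cl'[OF GH(2,4)] unfolding infinite_nat_iff_unbounded by blast+
    obtain i t where t: "t \<in> V (e i) \<inter> H"
      using H by blast
    obtain k s where ks: "k > e i" "s \<in> V k \<inter> G"
      using G by blast
    obtain j t' where t': "j > k" "t' \<in> V (e j) \<inter> H"
      using H by blast
    have "k < e j"
      using t'(1) strict_mono_imp_increasing[OF e(1), of j] by linarith
    then have "t \<sqsubset> s" "s \<sqsubset> t'"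
      using asc t ks t' by blast+
    moreover have "s \<in> X" "t \<in> X" "t' \<in> X"
      using t ks t' VX by blast+
    ultimately show False
      using GH(5) t ks t' asym[of t s] asym[of s t'] by blast
  qed
qed

text \<open>The sets accumulate at \<open>q\<close> from below. Choose a point of some member below \<open>q\<close>,
  separate it from \<open>q\<close> by ordered clopen sets \<open>V\<close> and \<open>W\<close>, and continue inside
  \<open>W\<close>: everything chosen later lies above \<open>V\<close>.\<close>

lemma ascending_subsequence:
  assumes U: "\<And>n::nat. clopenin T (U n)" "disjoint_family U"
    and q: "q \<in> X" "\<And>W. clopenin T W \<Longrightarrow> q \<in> W \<Longrightarrow> infinite {n. U n \<inter> W \<inter> below q \<noteq> {}}"
  obtains n V where "strict_mono (n :: nat \<Rightarrow> nat)" "\<And>k. clopenin T (V k)" "\<And>k. V k \<noteq> {}"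
    "\<And>k. V k \<subseteq> U (n k)" "\<And>i k s t. \<lbrakk>i < k; s \<in> V i; t \<in> V k\<rbrakk> \<Longrightarrow> s \<sqsubset> t"
proof -
  \<comment> \<open>At most one of the disjoint sets contains \<open>q\<close>, and from then on \<open>q\<close> can be separated from them.\<close>
  obtain K where K: "\<And>n. n > K \<Longrightarrow> q \<notin> U n"
  proof (cases "\<exists>n. q \<in> U n")
    case True
    then obtain K where "q \<in> U K" ..
    then have "q \<notin> U n" if "n > K" for n
      using disjoint_family_onD[OF U(2), of n K] that by auto
    then show thesis
      using that by blast
  next
    case False
    then show thesis
      using that by blast
  qed
  define P where "P k S \<longleftrightarrow> (case S of (n, V, W) \<Rightarrow> clopenin T V \<and> V \<noteq> {} \<and> V \<subseteq> U n \<and>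
    clopenin T W \<and> q \<in> W \<and> (\<forall>s\<in>V. \<forall>t\<in>W. s \<sqsubset> t))" for k :: nat and S
  define Q where "Q k S S' \<longleftrightarrow> (case S of (n, V, W) \<Rightarrow> case S' of (n', V', W') \<Rightarrow>
    n < n' \<and> V' \<subseteq> W \<and> W' \<subseteq> W)" for k :: nat and S :: "nat \<times> 'a set \<times> 'a set" and S'
  have step: "\<exists>n V' W'. P k (n, V', W') \<and> N < n \<and> V' \<subseteq> W \<and> W' \<subseteq> W"
    if W: "clopenin T W" "q \<in> W" for k N W
  proof -
    obtain n where n: "n > max N K" "U n \<inter> W \<inter> below q \<noteq> {}"
      using q(2)[OF W] unfolding infinite_nat_iff_unbounded by blast
    then obtain y where y: "y \<in> U n" "y \<in> W" "y \<sqsubset> q" "y \<in> X"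
      by (auto simp: below_def)
    moreover have qn: "q \<in> X - U n"
      using K[of n] n q by auto
    ultimately obtain A B where AB: "clopenin T A" "clopenin T B" "y \<in> A" "q \<in> B"
      "\<forall>s\<in>A. \<forall>t\<in>B. s \<sqsubset> t"
      using clopen_order_constant[OF U(1)[of n] y(1) qn] asym[of y q] q(1) by metis
    then show ?thesis
      using U(1) W y n
      by (intro exI[of _ n] exI[of _ "A \<inter> U n \<inter> W"] exI[of _ "B \<inter> W"])
        (auto simp: P_def intro!: clopenin_Int)
  qed
  have "\<exists>S. \<forall>k. P k (S k) \<and> Q k (S k) (S (Suc k))"
  proof (rule dependent_nat_choice)
    show "\<exists>S. P 0 S"
      using step[of X] q(1) by fastforce
    show "\<exists>S'. P (Suc k) S' \<and> Q k S S'" if "P k S" for k S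
    proof -
      obtain n V W where S: "S = (n, V, W)"
        by (cases S)
      then have "clopenin T W" "q \<in> W"
        using that by (auto simp: P_def)
      then show ?thesis
        using step[of W "Suc k" n] by (fastforce simp: S Q_def)
    qed
  qed
  then obtain S where S: "\<And>k. P k (S k)" "\<And>k. Q k (S k) (S (Suc k))"
    by blast
  define n V W where "n k = fst (S k)" and "V k = fst (snd (S k))" and "W k = snd (snd (S k))" for k
  have P: "clopenin T (V k)" "V k \<noteq> {}" "V k \<subseteq> U (n k)" "\<forall>s\<in>V k. \<forall>t\<in>W k. s \<sqsubset> t" for k
    using S(1)[of k] by (auto simp: P_def n_def V_def W_def split: prod.splits)
  have Q: "n k < n (Suc k)" "V (Suc k) \<subseteq> W k" "W (Suc k) \<subseteq> W k" for k
    using S(2)[of k] by (auto simp: Q_def n_def V_def W_def split: prod.splits)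
  have VW: "V k \<subseteq> W i" if "i < k" for i k
    using that
  proof (induction k)
    case (Suc k)
    have "W k \<subseteq> W i"
      using Suc.prems lift_Suc_antimono_le[of W i k] Q(3) by auto
    then show ?case
      using Q(2)[of k] by blast
  qed simp
  show thesis
  proof (rule that)
    show "strict_mono n"
      using Q(1) by (simp add: strict_mono_Suc_iff)
    show "s \<sqsubset> t" if "i < k" "s \<in> V i" "t \<in> V k" for i k s t
      using P(4)[of i] VW[OF that(1)] that by blast
  qed (use P in auto)
qed

lemma convergent_points_below:
  assumes U: "\<And>n::nat. clopenin T (U n)" "disjoint_family U"
    and q: "q \<in> X" "\<And>W. clopenin T W \<Longrightarrow> q \<in> W \<Longrightarrow> infinite {n. U n \<inter> W \<inter> below q \<noteq> {}}"
  shows "\<exists>n z x. strict_mono (n :: nat \<Rightarrow> nat) \<and> (\<forall>k. z k \<in> U (n k)) \<and> x \<in> X \<and>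
    (\<forall>W. clopenin T W \<longrightarrow> x \<in> W \<longrightarrow> (\<forall>\<^sub>F k in sequentially. z k \<in> W))"
proof -
  obtain n V where n: "strict_mono (n :: nat \<Rightarrow> nat)" and V: "\<And>k. clopenin T (V k)" "\<And>k. V k \<noteq> {}"
      "\<And>k. V k \<subseteq> U (n k)" "\<And>i k s t. \<lbrakk>i < k; s \<in> V i; t \<in> V k\<rbrakk> \<Longrightarrow> s \<sqsubset> t"
    by (rule ascending_subsequence[OF U q]) (assumption+, rule that)
  obtain x where x: "x \<in> X" "\<And>W. clopenin T W \<Longrightarrow> x \<in> W \<Longrightarrow> \<forall>\<^sub>F k in sequentially. V k \<subseteq> W"
    by (rule ascending_clopens_converge[of V, OF V(1,2)]) (erule (2) V(4), rule that)
  define z where "z k = (SOME y. y \<in> V k)" for k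
  have z: "z k \<in> V k" for k
    unfolding z_def using V(2)[of k] by (simp add: some_in_eq)
  have "\<forall>\<^sub>F k in sequentially. z k \<in> W" if "clopenin T W" "x \<in> W" for W
    using x(2)[OF that] by (rule eventually_mono) (use z in blast)
  moreover have "z k \<in> U (n k)" for k
    using z V(3) by blast
  ultimately show ?thesis
    using n x(1) by blast
qed

text \<open>A cluster point is approached from below or from above, and the two cases are dual. Sequential
  compactness of this kind passes to pairs of sequences, which cluster points alone do not.\<close>

lemma disjoint_clopens_convergent_points:
  assumes U: "\<And>n::nat. clopenin T (U n)" "\<And>n. U n \<noteq> {}" "disjoint_family U"
  shows "\<exists>n z x. strict_mono (n :: nat \<Rightarrow> nat) \<and> (\<forall>k. z k \<in> U (n k)) \<and> x \<in> X \<and>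
    (\<forall>W. clopenin T W \<longrightarrow> x \<in> W \<longrightarrow> (\<forall>\<^sub>F k in sequentially. z k \<in> W))"
proof -
  interpret dual: quasi_king_tournament T "\<lambda>x y. y \<sqsubset> x"
    by (rule dual_quasi_king_tournament)
  have dual_below: "dual.below = above"
    by (simp add: fun_eq_iff dual.below_def above_def)
  obtain q where q: "q \<in> X" "\<And>W. clopenin T W \<Longrightarrow> q \<in> W \<Longrightarrow> infinite {n. U n \<inter> W \<noteq> {}}"
    by (rule disjoint_clopens_cluster[of U, OF U]) (rule that)
  show ?thesis
  proof (cases "\<forall>W. clopenin T W \<and> q \<in> W \<longrightarrow> infinite {n. U n \<inter> W \<inter> below q \<noteq> {}}")
    case True
    then show ?thesis
      using convergent_points_below[OF U(1,3) q(1)] by simp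
  next
    case False
    then obtain W where W: "clopenin T W" "q \<in> W" "finite {n. U n \<inter> W \<inter> below q \<noteq> {}}"
      by blast
    have fin_q: "finite {n. q \<in> U n}"
    proof (cases "\<exists>n. q \<in> U n")
      case True
      then obtain n where "q \<in> U n" ..
      then have "{n. q \<in> U n} \<subseteq> {n}"
        using disjoint_family_onD[OF U(3), of _ n] by auto
      then show ?thesis
        using finite_subset by blast
    qed simp
    have "infinite {n. U n \<inter> W' \<inter> dual.below q \<noteq> {}}" if W': "clopenin T W'" "q \<in> W'" for W'
    proof
      assume "finite {n. U n \<inter> W' \<inter> dual.below q \<noteq> {}}"
      with fin_q W(3) have "finite ({n. U n \<inter> W \<inter> below q \<noteq> {}} \<union>
          {n. U n \<inter> W' \<inter> above q \<noteq> {}} \<union> {n. q \<in> U n})"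
        by (simp add: dual_below)
      moreover have "{n. U n \<inter> (W \<inter> W') \<noteq> {}} \<subseteq> {n. U n \<inter> W \<inter> below q \<noteq> {}} \<union>
          {n. U n \<inter> W' \<inter> above q \<noteq> {}} \<union> {n. q \<in> U n}"
      proof
        fix n assume "n \<in> {n. U n \<inter> (W \<inter> W') \<noteq> {}}"
        then obtain y where y: "y \<in> U n" "y \<in> W" "y \<in> W'"
          by blast
        moreover have "y \<in> X"
          using y(2) clopenin_subset[OF W(1)] by blast
        ultimately consider "y = q" | "y \<in> below q" | "y \<in> above q"
          using total[of y q] q(1) unfolding below_def above_def by blast
        then show "n \<in> {n. U n \<inter> W \<inter> below q \<noteq> {}} \<union>
          {n. U n \<inter> W' \<inter> above q \<noteq> {}} \<union> {n. q \<in> U n}"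
          using y by cases blast+
      qed
      ultimately have "finite {n. U n \<inter> (W \<inter> W') \<noteq> {}}"
        by (rule rev_finite_subset)
      then show False
        using q(2)[of "W \<inter> W'"] W W' by (simp add: clopenin_Int)
    qed
    then show ?thesis
      by (rule dual.convergent_points_below[OF U(1,3) q(1)])
  qed
qed

section \<open>Finitely many traces\<close>

text \<open>This is the fact that a clopen subset of a pseudocompact product \<open>M \<times> C\<close> has a clopen
  projection, applied to the pairs \<open>(m, c)\<close> whose order differs from that of \<open>(m0, c)\<close>.
  If \<open>m0\<close> were a limit of points with a different trace, one could choose disjoint rectangles
  \<open>U i \<times> G i\<close> such that the order between \<open>U i\<close> and \<open>G i\<close> is opposite to that
  between \<open>U j\<close> and \<open>G i\<close> for all \<open>j > i\<close>. Passing to convergent subsequences in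
  both factors contradicts that the order is constant near the pair of limits.\<close>

lemma trace_locally_constant:
  assumes M: "clopenin T M" and C: "clopenin T C" and MC: "M \<inter> C = {}" and m0: "m0 \<in> M"
  shows "\<exists>W. clopenin T W \<and> m0 \<in> W \<and> W \<subseteq> M \<and> (\<forall>m\<in>W. C \<inter> below m = C \<inter> below m0)"
proof (rule ccontr)
  assume contra: "\<not> ?thesis"
  have CX: "C \<subseteq> X - M"
    using clopenin_subset[OF C] MC by blast
  have const: "\<exists>A B. clopenin T A \<and> clopenin T B \<and> m \<in> A \<and> c \<in> B \<and>
    (\<forall>u\<in>A. \<forall>v\<in>B. v \<sqsubset> u \<longleftrightarrow> c \<sqsubset> m)" if mc: "m \<in> M" "c \<in> C" for m c
  proof -
    have "c \<in> X - M"
      using mc CX by blast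
    then obtain A B where AB: "clopenin T A" "clopenin T B" "m \<in> A" "c \<in> B"
      "(\<forall>s\<in>A. \<forall>t\<in>B. s \<sqsubset> t) \<or> (\<forall>s\<in>A. \<forall>t\<in>B. t \<sqsubset> s)"
      using clopen_order_constant[OF M mc(1)] by metis
    have "\<not> t \<sqsubset> s" if "s \<in> A" "t \<in> B" "s \<sqsubset> t" for s t
      using that AB(1,2) clopenin_subset asym[of s t] by blast
    then have "\<forall>u\<in>A. \<forall>v\<in>B. v \<sqsubset> u \<longleftrightarrow> c \<sqsubset> m"
      using AB(3-5) by metis
    then show ?thesis
      using AB by blast
  qed
  \<comment> \<open>The set \<open>W\<close> is the part of a neighbourhood of \<open>m0\<close> in which all later choices of
    \<open>U\<close> are made.\<close>
  define P where "P k S \<longleftrightarrow> (case S of (U, G, W) \<Rightarrow>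
    clopenin T U \<and> U \<noteq> {} \<and> U \<subseteq> M \<and> clopenin T G \<and> G \<noteq> {} \<and> G \<subseteq> C \<and>
    clopenin T W \<and> m0 \<in> W \<and> W \<subseteq> M \<and> (\<forall>u\<in>U. \<forall>g\<in>G. \<forall>w\<in>W. g \<sqsubset> u \<longleftrightarrow> \<not> g \<sqsubset> w))"
    for k :: nat and S
  define Q where "Q k S S' \<longleftrightarrow> (case S of (U, G, W) \<Rightarrow> case S' of (U', G', W') \<Rightarrow>
    U' \<subseteq> W \<and> W' \<subseteq> W)" for k :: nat and S S' :: "'a set \<times> 'a set \<times> 'a set"
  have step: "\<exists>S'. P k S' \<and> fst S' \<subseteq> W \<and> snd (snd S') \<subseteq> W"
    if W: "clopenin T W" "m0 \<in> W" "W \<subseteq> M" for k W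
  proof -
    obtain m where m: "m \<in> W" "C \<inter> below m \<noteq> C \<inter> below m0"
      using contra W by blast
    then obtain c where c: "c \<in> C" "c \<sqsubset> m \<longleftrightarrow> \<not> c \<sqsubset> m0"
      using CX by (auto simp: below_def)
    obtain A B where AB: "clopenin T A" "clopenin T B" "m \<in> A" "c \<in> B"
      "\<forall>u\<in>A. \<forall>v\<in>B. v \<sqsubset> u \<longleftrightarrow> c \<sqsubset> m"
      using const[of m c] m W(3) c by blast
    obtain A' B' where AB': "clopenin T A'" "clopenin T B'" "m0 \<in> A'" "c \<in> B'"
      "\<forall>u\<in>A'. \<forall>v\<in>B'. v \<sqsubset> u \<longleftrightarrow> c \<sqsubset> m0"
      using const[of m0 c] m0 c by blast
    have "clopenin T (W \<inter> A)" "clopenin T (C \<inter> B \<inter> B')" "clopenin T (W \<inter> A')"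
      using W(1) AB(1,2) AB'(1,2) C by (simp_all add: clopenin_Int)
    moreover have "\<forall>u\<in>W \<inter> A. \<forall>g\<in>C \<inter> B \<inter> B'. \<forall>w\<in>W \<inter> A'. g \<sqsubset> u \<longleftrightarrow> \<not> g \<sqsubset> w"
      using AB(5) AB'(5) c(2) by blast
    moreover have "m \<in> W \<inter> A" "c \<in> C \<inter> B \<inter> B'" "m0 \<in> W \<inter> A'"
      using W(2) m(1) c(1) AB(3,4) AB'(3,4) by blast+
    ultimately have "P k (W \<inter> A, C \<inter> B \<inter> B', W \<inter> A')"
      unfolding P_def prod.case using W(3) by blast
    then show ?thesis
      by (intro exI[of _ "(W \<inter> A, C \<inter> B \<inter> B', W \<inter> A')"]) auto
  qed
  have "\<exists>S. \<forall>k. P k (S k) \<and> Q k (S k) (S (Suc k))"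
  proof (rule dependent_nat_choice)
    show "\<exists>S. P 0 S"
      using step[OF M m0] by blast
    show "\<exists>S'. P (Suc k) S' \<and> Q k S S'" if "P k S" for k S
    proof -
      obtain U G W where S: "S = (U, G, W)"
        by (cases S)
      then have "clopenin T W" "m0 \<in> W" "W \<subseteq> M"
        using that by (auto simp: P_def)
      then obtain S' where "P (Suc k) S'" "fst S' \<subseteq> W" "snd (snd S') \<subseteq> W"
        using step[of W "Suc k"] by blast
      then show ?thesis
        by (intro exI[of _ S']) (auto simp: S Q_def split: prod.splits)
    qed
  qed
  then obtain S where S: "\<And>k. P k (S k)" "\<And>k. Q k (S k) (S (Suc k))"
    by blast
  define U G W where "U k = fst (S k)" and "G k = fst (snd (S k))" and "W k = snd (snd (S k))" for k
  have U: "clopenin T (U k)" "U k \<noteq> {}" "U k \<subseteq> M" and G: "clopenin T (G k)" "G k \<noteq> {}" "G k \<subseteq> C"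
    and W: "m0 \<in> W k" and flip: "\<And>u g w. \<lbrakk>u \<in> U k; g \<in> G k; w \<in> W k\<rbrakk> \<Longrightarrow> g \<sqsubset> u \<longleftrightarrow> \<not> g \<sqsubset> w" for k
    using S(1)[of k] by (auto simp: P_def U_def G_def W_def split: prod.splits)
  have dec: "U (Suc k) \<subseteq> W k" "W (Suc k) \<subseteq> W k" for k
    using S(2)[of k] by (auto simp: Q_def U_def W_def split: prod.splits)
  have UW: "U j \<subseteq> W i" if "i < j" for i j
    using that
  proof (induction j)
    case (Suc j)
    have "W j \<subseteq> W i"
      using Suc.prems lift_Suc_antimono_le[of W i j] dec(2) by auto
    then show ?case
      using dec(1)[of j] by blast
  qed simp
  have alternate: "g \<sqsubset> u \<longleftrightarrow> \<not> g \<sqsubset> v" if "i < j" "u \<in> U i" "v \<in> U j" "g \<in> G i" for i j u v g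
    using flip[of u i g v] UW[OF that(1)] that by blast
  have U_disj: "U i \<inter> U j = {}" if "i < j" for i j
    using alternate[OF that] G(2)[of i] by blast
  have G_disj: "G i \<inter> G j = {}" if "i < j" for i j
  proof (rule ccontr)
    assume "G i \<inter> G j \<noteq> {}"
    then obtain g where g: "g \<in> G i" "g \<in> G j" by blast
    obtain u v where uv: "u \<in> U i" "v \<in> U j"
      using U(2) by blast
    have "g \<sqsubset> u \<longleftrightarrow> \<not> g \<sqsubset> v" "g \<sqsubset> u \<longleftrightarrow> \<not> g \<sqsubset> m0" "g \<sqsubset> v \<longleftrightarrow> \<not> g \<sqsubset> m0"
      using alternate[OF that uv g(1)] flip[OF uv(1) g(1) W] flip[OF uv(2) g(2) W] by blast+
    then show False by blast
  qed
  have U_fam: "disjoint_family U" and G_fam: "disjoint_family G"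
    using U_disj G_disj unfolding disjoint_family_on_def by (metis Int_commute neq_iff)+
  obtain n z x where n: "strict_mono (n :: nat \<Rightarrow> nat)" and z: "\<And>k. z k \<in> U (n k)" and x: "x \<in> X"
    "\<And>Z. clopenin T Z \<Longrightarrow> x \<in> Z \<Longrightarrow> \<forall>\<^sub>F k in sequentially. z k \<in> Z"
    using disjoint_clopens_convergent_points[of U, OF U(1,2) U_fam] by blast
  have "disjoint_family (\<lambda>k. G (n k))"
    using G_fam strict_mono_eq[OF n] by (simp add: disjoint_family_on_def)
  then obtain p y' y where p: "strict_mono (p :: nat \<Rightarrow> nat)" and y': "\<And>k. y' k \<in> G (n (p k))"
    and y: "y \<in> X" "\<And>Z. clopenin T Z \<Longrightarrow> y \<in> Z \<Longrightarrow> \<forall>\<^sub>F k in sequentially. y' k \<in> Z"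
    using disjoint_clopens_convergent_points[of "\<lambda>k. G (n k)", OF G(1,2)] by blast
  have "x \<in> M"
  proof (rule ccontr)
    assume "x \<notin> M"
    then have "\<forall>\<^sub>F k in sequentially. z k \<in> X - M"
      using x M by (intro x(2)) (auto intro: clopenin_Diff)
    then show False
      using z U(3) by (auto simp: eventually_sequentially)
  qed
  moreover have "y \<in> C"
  proof (rule ccontr)
    assume "y \<notin> C"
    then have "\<forall>\<^sub>F k in sequentially. y' k \<in> X - C"
      using y C by (intro y(2)) (auto intro: clopenin_Diff)
    then show False
      using y' G(3) by (auto simp: eventually_sequentially)
  qed
  ultimately obtain A B where AB: "clopenin T A" "clopenin T B" "x \<in> A" "y \<in> B"
      "\<forall>u\<in>A. \<forall>v\<in>B. v \<sqsubset> u \<longleftrightarrow> y \<sqsubset> x"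
    using const[of x y] by blast
  obtain K where K: "\<And>k. k \<ge> K \<Longrightarrow> z k \<in> A"
    using x(2)[OF AB(1,3)] by (auto simp: eventually_sequentially)
  obtain L where L: "\<And>k. k \<ge> L \<Longrightarrow> y' k \<in> B"
    using y(2)[OF AB(2,4)] by (auto simp: eventually_sequentially)
  \<comment> \<open>The two subsequences are \<open>n\<close> and \<open>n \<circ> p\<close>. Their members \<open>U (n (p i))\<close>
    and \<open>U (n (Suc (p i)))\<close> are compared with \<open>G (n (p i))\<close>.\<close>
  define i where "i = max K L"
  have "K \<le> p i" "L \<le> i"
    using strict_mono_imp_increasing[OF p, of i] by (auto simp: i_def)
  then have "z (p i) \<in> A" "z (Suc (p i)) \<in> A" "y' i \<in> B"
    using K[of "p i"] K[of "Suc (p i)"] L[of i] by simp_all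
  then have "y' i \<sqsubset> z (p i) \<longleftrightarrow> y' i \<sqsubset> z (Suc (p i))"
    using AB(5) by simp
  moreover have "n (p i) < n (Suc (p i))"
    using n by (simp add: strict_mono_Suc_iff)
  ultimately show False
    using alternate[OF _ z[of "p i"] z[of "Suc (p i)"] y'[of i]] by blast
qed

text \<open>The sets of points with a given trace are clopen and disjoint, so infinitely many of them
  would cluster at a point; but every point has a neighbourhood meeting at most one of them.\<close>

lemma finite_traces:
  assumes M: "clopenin T M" and C: "clopenin T C" and MC: "M \<inter> C = {}"
  shows "finite ((\<lambda>m. C \<inter> below m) ` M)"
proof (rule ccontr)
  assume "infinite ((\<lambda>m. C \<inter> below m) ` M)"
  then obtain g :: "nat \<Rightarrow> 'a set" where g: "inj g" "range g \<subseteq> (\<lambda>m. C \<inter> below m) ` M"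
    using infinite_countable_subset by blast
  define U where "U n = {m \<in> M. C \<inter> below m = g n}" for n
  have MX: "M \<subseteq> X"
    using M by (rule clopenin_subset)
  have clo: "clopenin T (U n)" for n
  proof (rule clopeninI_local)
    fix x assume "x \<in> U n"
    then have x: "x \<in> M" "C \<inter> below x = g n"
      by (auto simp: U_def)
    obtain W where W: "clopenin T W" "x \<in> W" "W \<subseteq> M" "\<forall>m\<in>W. C \<inter> below m = C \<inter> below x"
      using trace_locally_constant[OF M C MC x(1)] by blast
    then have "W \<subseteq> U n"
      using x(2) by (auto simp: U_def)
    then show "\<exists>W. openin T W \<and> x \<in> W \<and> W \<subseteq> U n"
      using W by (auto simp: clopenin_def)
  next
    fix x assume x: "x \<in> X - U n"
    show "\<exists>W. openin T W \<and> x \<in> W \<and> W \<inter> U n = {}"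
    proof (cases "x \<in> M")
      case True
      obtain W where W: "clopenin T W" "x \<in> W" "\<forall>m\<in>W. C \<inter> below m = C \<inter> below x"
        using trace_locally_constant[OF M C MC True] by blast
      have "m \<notin> U n" if "m \<in> W" for m
        using bspec[OF W(3) that] x True by (simp add: U_def)
      then have "W \<inter> U n = {}"
        by blast
      then show ?thesis
        using W by (auto simp: clopenin_def)
    next
      case False
      then show ?thesis
        using x clopenin_Diff[OF clopenin_topspace M]
        by (intro exI[of _ "X - M"]) (auto simp: clopenin_def U_def)
    qed
  qed (use MX in \<open>auto simp: U_def\<close>)
  have ne: "U n \<noteq> {}" for n
  proof -
    have "g n \<in> (\<lambda>m. C \<inter> below m) ` M"
      using g(2) by blast
    then show ?thesis
      unfolding U_def by blast
  qed
  have "U i \<inter> U j = {}" if "i \<noteq> j" for i j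
    using injD[OF g(1), of i j] that unfolding U_def by blast
  then have "disjoint_family U"
    by (simp add: disjoint_family_on_def)
  then obtain x where x: "x \<in> X"
    and cl: "\<And>W. clopenin T W \<Longrightarrow> x \<in> W \<Longrightarrow> infinite {n. U n \<inter> W \<noteq> {}}"
    using disjoint_clopens_cluster[of U, OF clo ne] by blast
  show False
  proof (cases "x \<in> M")
    case True
    then obtain W where W: "clopenin T W" "x \<in> W" "\<forall>m\<in>W. C \<inter> below m = C \<inter> below x"
      using trace_locally_constant[OF M C MC] by blast
    have trace: "g n = C \<inter> below x" if n: "U n \<inter> W \<noteq> {}" for n
    proof -
      obtain u where "u \<in> U n" "u \<in> W"
        using n by blast
      then show ?thesis
        using bspec[OF W(3), of u] by (simp add: U_def)
    qed
    obtain i where i: "U i \<inter> W \<noteq> {}"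
      using infinite_imp_nonempty[OF cl[OF W(1,2)]] by blast
    have "{n. U n \<inter> W \<noteq> {}} \<subseteq> {i}"
    proof
      fix j assume "j \<in> {n. U n \<inter> W \<noteq> {}}"
      then have "g j = C \<inter> below x" "g i = C \<inter> below x"
        using trace i by blast+
      then show "j \<in> {i}"
        using injD[OF g(1), of j i] by simp
    qed
    then show False
      using cl[OF W(1,2)] finite_subset by blast
  next
    case False
    have "clopenin T (X - M)"
      using M by (simp add: clopenin_Diff)
    moreover have "{n. U n \<inter> (X - M) \<noteq> {}} = {}"
      by (auto simp: U_def)
    ultimately show False
      using cl[of "X - M"] x False by simp
  qed
qed

section \<open>Every prime ideal of clopen sets is fixed\<close>

text \<open>View the free ideal \<open>J\<close> as a missing point; the assumption \<open>low\<close> says that this point lies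
  above every point of \<open>A\<close>. Starting from a quasi-king \<open>q\<close> of \<open>A\<close>, one collects
  the points that reach \<open>q\<close> in at most \<open>k\<close> steps in a set \<open>S k\<close> of the ideal:
  by finiteness of traces, the predecessors of a set in the ideal are again contained in a set of the ideal. These
  sets exhaust \<open>A\<close>, so \<open>A\<close> is one of them: a decreasing sequence of nonempty clopen
  sets has nonempty intersection.\<close>

lemma prime_ideal_not_above_clopen:
  assumes J: "prime_clopen_ideal T J" and free: "\<And>x. x \<in> X \<Longrightarrow> \<exists>U\<in>J. x \<in> U"
    and A: "clopenin T A"
    and low: "\<And>x C. \<lbrakk>x \<in> A; clopenin T C; x \<notin> C\<rbrakk> \<Longrightarrow> C \<inter> below x \<in> J"
  shows "A \<in> J"
proof (cases "A = {}")
  case True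
  then show ?thesis
    using prime_clopen_idealD(4)[OF J, of "{}" "{}"] by simp
next
  case False
  have AX: "A \<subseteq> X"
    using A by (rule clopenin_subset)
  obtain q where q: "q \<in> A" and king: "\<And>x. x \<in> A \<Longrightarrow> (\<lambda>u v. u \<in> A \<and> v \<in> A \<and> u \<sqsubset> v)\<^sup>*\<^sup>* x q"
    using clopen_quasi_king[OF A False] by blast
  have step: "\<exists>S'. S' \<in> J \<and> S' \<subseteq> A \<and> S \<subseteq> S' \<and> (\<forall>s\<in>S. \<forall>y\<in>A. y \<sqsubset> s \<longrightarrow> y \<in> S')"
    if S: "S \<in> J" "S \<subseteq> A" for S
  proof -
    have clo: "clopenin T S" "clopenin T (X - S)"
      using prime_clopen_idealD(1)[OF J] S(1) by (simp_all add: clopenin_Diff)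
    define \<F> where "\<F> = insert S ((\<lambda>m. (X - S) \<inter> below m) ` S)"
    have \<F>: "finite \<F>" "\<F> \<subseteq> J"
      using finite_traces[OF clo] low S clo by (auto simp: \<F>_def)
    have "clopenin T (\<Union>\<F> \<inter> A)"
      using \<F> prime_clopen_idealD(1)[OF J] A by (intro clopenin_Int clopenin_Union) auto
    then have "\<Union>\<F> \<inter> A \<in> J"
      using prime_clopen_idealD(4)[OF J _ \<F>] by blast
    then show ?thesis
      using S AX by (intro exI[of _ "\<Union>\<F> \<inter> A"]) (auto simp: \<F>_def below_def)
  qed
  have "\<exists>S. \<forall>k. (S k \<in> J \<and> S k \<subseteq> A \<and> q \<in> S k) \<and>
    (S k \<subseteq> S (Suc k) \<and> (\<forall>s\<in>S k. \<forall>y\<in>A. y \<sqsubset> s \<longrightarrow> y \<in> S (Suc k)))"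
  proof (rule dependent_nat_choice)
    obtain U where U: "U \<in> J" "q \<in> U"
      using free q AX by blast
    then have "U \<inter> A \<in> J"
      using prime_clopen_ideal_Un[OF J _ U(1) U(1)] prime_clopen_idealD(1)[OF J] A
      by (auto intro: clopenin_Int)
    then show "\<exists>S. S \<in> J \<and> S \<subseteq> A \<and> q \<in> S"
      using U q by blast
  next
    fix S :: "'a set" and k :: nat
    assume "S \<in> J \<and> S \<subseteq> A \<and> q \<in> S"
    then show "\<exists>S'. (S' \<in> J \<and> S' \<subseteq> A \<and> q \<in> S') \<and>
      (S \<subseteq> S' \<and> (\<forall>s\<in>S. \<forall>y\<in>A. y \<sqsubset> s \<longrightarrow> y \<in> S'))"
      using step[of S] by blast
  qed
  then obtain S where S: "\<And>k. S k \<in> J" "\<And>k. S k \<subseteq> A" "\<And>k. q \<in> S k" "\<And>k. S k \<subseteq> S (Suc k)"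
    "\<And>k s y. \<lbrakk>s \<in> S k; y \<in> A; y \<sqsubset> s\<rbrakk> \<Longrightarrow> y \<in> S (Suc k)"
    by blast
  have reach: "\<exists>k. x \<in> S k" if "x \<in> A" for x
    using king[OF that]
  proof (induction rule: converse_rtranclp_induct)
    case (step u v)
    then show ?case
      using S(5) by blast
  qed (use S(3) in blast)
  have "clopenin T (A - S n)" for n
    using A prime_clopen_idealD(1)[OF J S(1)] by (rule clopenin_Diff)
  moreover have "decseq (\<lambda>n. A - S n)"
    using S(4) by (intro decseq_SucI) blast
  moreover have "(\<Inter>n. A - S n) = {}"
    using reach by blast
  ultimately obtain n where "A - S n = {}"
    using decreasing_clopens_eventually_empty[of "\<lambda>n. A - S n"] by blast
  then have "A = S n"
    using S(2) by blast
  then show ?thesis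
    using S(1) by simp
qed

text \<open>The order relation between a point and the place where a free ideal \<open>J\<close> converges is decided by
  \<open>J\<close>: either \<open>C \<inter> below x\<close> belongs to \<open>J\<close> for every clopen \<open>C\<close> that misses
  \<open>x\<close>, or \<open>C \<inter> above x\<close> does. Since traces are locally constant, the set
  \<open>A\<close> of points of the first kind is clopen. By the preceding lemma and its dual, \<open>A\<close> and
  its complement both belong to \<open>J\<close>, which is impossible.\<close>

theorem prime_clopen_ideal_fixed:
  assumes J: "prime_clopen_ideal T J"
  shows "\<exists>x\<in>X. \<forall>U\<in>J. x \<notin> U"
proof (rule ccontr)
  assume "\<not> ?thesis"
  then have free: "\<And>x. x \<in> X \<Longrightarrow> \<exists>U\<in>J. x \<in> U"
    by blast
  interpret dual: quasi_king_tournament T "\<lambda>x y. y \<sqsubset> x"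
    by (rule dual_quasi_king_tournament)
  have dual_below: "dual.below = above"
    by (simp add: fun_eq_iff dual.below_def above_def)
  define A where "A = {x \<in> X. \<forall>C. clopenin T C \<longrightarrow> x \<notin> C \<longrightarrow> C \<inter> below x \<in> J}"
  have AI: "x \<in> A" if x: "x \<in> X" and U: "U \<in> J" "(X - U) \<inter> below x \<in> J" for x U
  proof -
    have "C \<inter> below x \<in> J" if C: "clopenin T C" "x \<notin> C" for C
      using x C clopenin_subset[OF C(1)]
      by (intro prime_clopen_ideal_Un[OF J clopenin_Int_below U]) auto
    then show ?thesis
      using x by (simp add: A_def)
  qed
  have high: "C \<inter> above x \<in> J" if x: "x \<in> X - A" and C: "clopenin T C" "x \<notin> C" for x C
  proof -
    obtain D where D: "clopenin T D" "x \<notin> D" "D \<inter> below x \<notin> J"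
      using x by (auto simp: A_def)
    then have "X - D \<inter> below x \<in> J"
      using x by (intro prime_clopen_idealD(3)[OF J] clopenin_Int_below) auto
    moreover have "C \<inter> above x \<subseteq> X - D \<inter> below x"
      using x asym by (auto simp: above_def below_def)
    ultimately show ?thesis
      using prime_clopen_ideal_Un[OF J clopenin_Int_above, of C x] x C by blast
  qed
  have A_local: "\<exists>W. openin T W \<and> x \<in> W \<and> (\<forall>w\<in>W. w \<in> A \<longleftrightarrow> x \<in> A)" if x: "x \<in> X" for x
  proof -
    obtain U where U: "U \<in> J" "x \<in> U"
      using free x by blast
    have clo: "clopenin T U" "clopenin T (X - U)"
      using prime_clopen_idealD(1)[OF J U(1)] by (simp_all add: clopenin_Diff)
    obtain W where W: "clopenin T W" "x \<in> W" "W \<subseteq> U"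
      "\<forall>w\<in>W. (X - U) \<inter> below w = (X - U) \<inter> below x"
      using trace_locally_constant[OF clo _ U(2)] by blast
    have iff: "w \<in> A \<longleftrightarrow> (X - U) \<inter> below w \<in> J" if w: "w \<in> W" for w
    proof
      assume "w \<in> A"
      then show "(X - U) \<inter> below w \<in> J"
        using clo(2) w W(3) unfolding A_def by blast
    next
      assume "(X - U) \<inter> below w \<in> J"
      moreover have "w \<in> X"
        using w clopenin_subset[OF W(1)] by blast
      ultimately show "w \<in> A"
        by (intro AI[OF _ U(1)])
    qed
    have "w \<in> A \<longleftrightarrow> x \<in> A" if "w \<in> W" for w
      using iff[OF that] iff[OF W(2)] bspec[OF W(4) that] by simp
    then show ?thesis
      using W(1,2) unfolding clopenin_def by blast
  qed
  have A: "clopenin T A"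
  proof (rule clopeninI_local)
    show AX: "A \<subseteq> X"
      by (auto simp: A_def)
    show "\<exists>W. openin T W \<and> x \<in> W \<and> W \<subseteq> A" if "x \<in> A" for x
      using A_local[of x] that AX by blast
    show "\<exists>W. openin T W \<and> x \<in> W \<and> W \<inter> A = {}" if "x \<in> X - A" for x
      using A_local[of x] that by blast
  qed
  have "A \<in> J"
    by (rule prime_ideal_not_above_clopen[OF J free A]) (auto simp: A_def)
  moreover have "X - A \<in> J"
    by (rule dual.prime_ideal_not_above_clopen[OF J free clopenin_Diff[OF clopenin_topspace A]])
      (use high in \<open>auto simp: dual_below\<close>)
  ultimately show False
    using prime_clopen_ideal_compl[OF J] by blast
qed

section \<open>Compactness\<close>

text \<open>If no finite subfamily covers, the clopen sets that are finitely covered lie in a prime ideal, which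
  misses some point \<open>x\<close>. No clopen neighbourhood of \<open>x\<close> lies in a single member, so the
  rays that meet the quasi-component \<open>Q\<close> of \<open>x\<close> are bounded by points of \<open>Q\<close>.
  A ray \<open>below l\<close> and a ray \<open>above r\<close> with \<open>r\<close> below \<open>l\<close> would cover the
  space. Hence every \<open>l\<close> precedes or equals every \<open>r\<close>, and the union of the rays
  \<open>below l\<close> is a clopen set that contains the minimum of \<open>Q\<close> but not its maximum.\<close>

lemma ray_cover_finite_subcover:
  assumes \<C>: "\<C> \<subseteq> insert X (below ` X \<union> above ` X)" "\<Union>\<C> = X"
  shows "\<exists>\<F>. finite \<F> \<and> \<F> \<subseteq> \<C> \<and> \<Union>\<F> = X"
proof (rule ccontr)
  assume contra: "\<not> ?thesis"
  have no_cover: "\<not> X \<subseteq> \<Union>\<F>" if "finite \<F>" "\<F> \<subseteq> \<C>" for \<F>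
    using contra that \<C>(2) by blast
  define I where "I = {U. clopenin T U \<and> (\<exists>\<F>. finite \<F> \<and> \<F> \<subseteq> \<C> \<and> U \<subseteq> \<Union>\<F>)}"
  have proper: "\<Union>\<G> \<noteq> X" if \<G>: "finite \<G>" "\<G> \<subseteq> I" for \<G>
  proof -
    have "\<exists>\<F>. finite \<F> \<and> \<F> \<subseteq> \<C> \<and> \<Union>\<G> \<subseteq> \<Union>\<F>"
      using \<G>
    proof (induction rule: finite_induct)
      case (insert U \<G>)
      then obtain \<F> \<F>' where "finite \<F>" "\<F> \<subseteq> \<C>" "\<Union>\<G> \<subseteq> \<Union>\<F>"
        "finite \<F>'" "\<F>' \<subseteq> \<C>" "U \<subseteq> \<Union>\<F>'"
        by (auto simp: I_def)
      then show ?case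
        by (intro exI[of _ "\<F> \<union> \<F>'"]) auto
    qed auto
    then obtain \<F> where "finite \<F>" "\<F> \<subseteq> \<C>" "\<Union>\<G> \<subseteq> \<Union>\<F>"
      by metis
    then show ?thesis
      using no_cover[of \<F>] by simp
  qed
  have clo: "clopenin T U" if "U \<in> I" for U
    using that by (simp add: I_def)
  obtain J where IJ: "I \<subseteq> J" and J: "prime_clopen_ideal T J"
    by (rule prime_clopen_ideal_extension[of I, OF clo proper]) (assumption | rule that)+
  obtain x where x: "x \<in> X" and fixed: "\<And>U. U \<in> J \<Longrightarrow> x \<notin> U"
    using prime_clopen_ideal_fixed[OF J] by metis
  have no_clopen: False if "clopenin T U" "x \<in> U" "U \<subseteq> c" "c \<in> \<C>" for U c
  proof -
    have "U \<in> I"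
      using that unfolding I_def by (auto intro!: exI[of _ "{c}"])
    then show False
      using IJ fixed that(2) by blast
  qed
  let ?Q = "quasi_component_of_set T x"
  have QX: "?Q \<subseteq> X"
    by (rule quasi_component_of_subset_topspace)
  have within: "quasi_component_of T y z" if "y \<in> ?Q" "z \<in> ?Q" for y z
    using that quasi_component_of_sym[of T x y] quasi_component_of_trans[of T y x z] by simp
  have Q_trans: "u \<sqsubset> w" if "u \<sqsubset> v" "v \<sqsubset> w" "u \<in> ?Q" "v \<in> ?Q" "w \<in> ?Q" for u v w
    using quasi_component_trans[OF that(1,2)] within that by blast
  have right: "y \<sqsubset> z" if "z \<in> X - ?Q" "x \<sqsubset> z" "y \<in> ?Q" for y z
    using outside_quasi_component_below[of x y z] that by simp
  have left: "z \<sqsubset> y" if "z \<in> X - ?Q" "z \<sqsubset> x" "y \<in> ?Q" for y z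
    using outside_quasi_component_above[of x y z] that by simp
  have sides: "x \<sqsubset> z \<or> z \<sqsubset> x" if "z \<in> X - ?Q" for z
    using total[of x z] that x by (cases "x = z") auto
  define L where "L = {y \<in> ?Q. below y \<in> \<C>}"
  define R where "R = {y \<in> ?Q. above y \<in> \<C>}"
  have cover: "(\<exists>l\<in>L. q \<sqsubset> l) \<or> (\<exists>r\<in>R. r \<sqsubset> q)" if q: "q \<in> ?Q" for q
  proof -
    have "q \<in> \<Union>\<C>"
      unfolding \<C>(2) using q QX by blast
    then obtain c where c: "c \<in> \<C>" "q \<in> c"
      by blast
    have "c \<in> insert X (below ` X \<union> above ` X)"
      using subsetD[OF \<C>(1) c(1)] .
    then consider "c = X" | y where "y \<in> X" "c = below y" | y where "y \<in> X" "c = above y"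
      by blast
    then show ?thesis
    proof cases
      case 1
      then show ?thesis
        using no_clopen[of X c] x c by simp
    next
      case 2
      then have "q \<sqsubset> y"
        using c by (simp add: below_def)
      have "y \<in> ?Q"
      proof (rule ccontr)
        assume y: "y \<notin> ?Q"
        then obtain W where W: "clopenin T W" "x \<in> W" "y \<notin> W"
          using quasi_component_separation[OF x 2(1)] by blast
        have "x \<sqsubset> y"
          using sides[of y] left[of y q] asym[of q y] \<open>q \<sqsubset> y\<close> y 2 q QX by blast
        then show False
          using no_clopen[OF clopenin_Int_below[OF W(1), of y] _ _ c(1)] W 2 x
          by (auto simp: below_def)
      qed
      then show ?thesis
        using c 2 \<open>q \<sqsubset> y\<close> by (auto simp: L_def)
    next
      case 3
      then have "y \<sqsubset> q"
        using c by (simp add: above_def)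
      have "y \<in> ?Q"
      proof (rule ccontr)
        assume y: "y \<notin> ?Q"
        then obtain W where W: "clopenin T W" "x \<in> W" "y \<notin> W"
          using quasi_component_separation[OF x 3(1)] by blast
        have "y \<sqsubset> x"
          using sides[of y] right[of y q] asym[of q y] \<open>y \<sqsubset> q\<close> y 3 q QX by blast
        then show False
          using no_clopen[OF clopenin_Int_above[OF W(1), of y] _ _ c(1)] W 3 x
          by (auto simp: above_def)
      qed
      then show ?thesis
        using c 3 \<open>y \<sqsubset> q\<close> by (auto simp: R_def)
    qed
  qed
  have L_le_R: "\<not> r \<sqsubset> l" if lr: "l \<in> L" "r \<in> R" for l r
  proof
    assume rl: "r \<sqsubset> l"
    have Q: "l \<in> ?Q" "r \<in> ?Q"
      using lr by (auto simp: L_def R_def)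
    have "w \<sqsubset> l \<or> r \<sqsubset> w" if w: "w \<in> X" for w
    proof (cases "w \<in> ?Q")
      case True
      then show ?thesis
        using total[of w l] Q_trans[OF rl _ Q(2,1) True] w Q QX rl by blast
    next
      case False
      then show ?thesis
        using sides[of w] left[of w l] right[of w r] w Q by blast
    qed
    then have "X \<subseteq> \<Union>{below l, above r}"
      by (auto simp: below_def above_def)
    then show False
      using no_cover[of "{below l, above r}"] lr by (auto simp: L_def R_def)
  qed
  obtain a where a: "a \<in> ?Q" "\<And>y. y \<in> ?Q \<Longrightarrow> y = a \<or> a \<sqsubset> y"
    by (rule quasi_component_has_min[OF x]) (rule that; simp)
  obtain b where b: "b \<in> ?Q" "\<And>y. y \<in> ?Q \<Longrightarrow> y = b \<or> y \<sqsubset> b"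
    by (rule quasi_component_has_max[OF x]) (rule that; simp)
  have LQ: "L \<subseteq> ?Q" and RQ: "R \<subseteq> ?Q"
    by (auto simp: L_def R_def)
  have "\<not> s \<sqsubset> a" if "s \<in> ?Q" for s
    using a(2)[OF that] that asym[of a s] irrefl[of a] a(1) QX by blast
  then obtain l where l: "l \<in> L" "a \<sqsubset> l"
    using cover[OF a(1)] RQ by blast
  have "\<not> b \<sqsubset> s" if "s \<in> ?Q" for s
    using b(2)[OF that] that asym[of b s] irrefl[of b] b(1) QX by blast
  then obtain r where r: "r \<in> R" "r \<sqsubset> b"
    using cover[OF b(1)] LQ by blast
  let ?H = "\<Union>(below ` L)"
  have compl: "X - ?H = \<Union>(above ` R)"
  proof (intro equalityI subsetI)
    fix w assume w: "w \<in> X - ?H"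
    show "w \<in> \<Union>(above ` R)"
    proof (cases "w \<in> ?Q")
      case True
      then show ?thesis
        using cover[OF True] w by (auto simp: below_def above_def)
    next
      case False
      then have "x \<sqsubset> w"
        using sides[of w] left[of w l] w l LQ by (auto simp: below_def)
      then show ?thesis
        using right[of w r] False w r RQ by (auto simp: above_def)
    qed
  next
    fix w assume "w \<in> \<Union>(above ` R)"
    then obtain s where s: "s \<in> R" "s \<sqsubset> w" "w \<in> X"
      by (auto simp: above_def)
    have "\<not> w \<sqsubset> k" if k: "k \<in> L" for k
    proof
      assume wk: "w \<sqsubset> k"
      show False
      proof (cases "w \<in> ?Q")
        case True
        then show False
          using Q_trans[OF s(2) wk] L_le_R[OF k s(1)] k s LQ RQ by blast
      next
        case False
        then have w: "w \<in> X - ?Q"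
          using s by blast
        then show False
          using sides[OF w] left[OF w, of s] right[OF w, of k] asym[of w k] asym[of s w] wk s k LQ RQ QX
          by blast
      qed
    qed
    then show "w \<in> X - ?H"
      using s by (auto simp: below_def)
  qed
  have "openin T ?H" "openin T (\<Union>(above ` R))"
    using LQ RQ QX by (auto intro!: openin_Union openin_below openin_above)
  then have "clopenin T ?H"
    using compl openin_subset[of T ?H] by (simp add: clopenin_def closedin_def)
  moreover have "a \<in> ?H"
    using l a QX by (auto simp: below_def)
  moreover have "b \<notin> ?H"
  proof -
    have "b \<in> \<Union>(above ` R)"
      using r b QX by (auto simp: above_def)
    then show ?thesis
      using compl by blast
  qed
  ultimately show False
    using quasi_component_in_clopen[OF within[OF a(1) b(1)]] by blast
qed

theorem compact_if_quasi_kings: "compact_space T"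
proof -
  let ?S = "insert X (below ` X \<union> above ` X)"
  have "?S = insert X ({{y \<in> X. y \<sqsubset> x} |x. x \<in> X} \<union> {{y \<in> X. x \<sqsubset> y} |x. x \<in> X})"
    by (auto simp: below_def above_def)
  then have T: "topology_generated_by ?S = T"
    by (metis topology_of_rays)
  have US: "\<Union>?S = X"
    by (auto simp: below_def above_def)
  have "compact_space (topology_generated_by ?S)"
  proof (rule generated_topology_compact)
    show "\<Union>?S \<in> ?S"
      unfolding US by (rule insertI1)
    fix \<C> assume \<C>: "\<C> \<subseteq> ?S" "\<Union>\<C> = \<Union>?S"
    then show "\<exists>\<F>. finite \<F> \<and> \<F> \<subseteq> \<C> \<and> \<Union>\<F> = \<Union>?S"
      unfolding US by (rule ray_cover_finite_subcover)
  qed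
  then show ?thesis
    unfolding T .
qed

end

theorem theorem6p1:
  fixes T :: "'a topology"
  assumes "Hausdorff_space T"
    and "selection_orderable T"
    and "quasi_king_space T"
  shows "compact_space T"
proof -
  let ?X = "topspace T"
  obtain \<phi> where \<phi>: "continuous_weak_selection T \<phi>" and T: "T = selection_topology ?X \<phi>"
    using assms(2) unfolding selection_orderable_def by blast
  have weak: "\<phi> {x, y} = x \<or> \<phi> {x, y} = y" if "x \<in> ?X" "y \<in> ?X" for x y
  proof -
    have "{x, y} \<in> F2 ?X"
      using that by (cases "x = y") (auto simp: F2_def)
    then show ?thesis
      using \<phi> unfolding continuous_weak_selection_def weak_selection_def by blast
  qed
  interpret quasi_king_tournament T "sel_less \<phi>"
  proof
    fix x y assume xy: "x \<in> ?X" "y \<in> ?X"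
    show "x \<noteq> y \<Longrightarrow> sel_less \<phi> x y \<or> sel_less \<phi> y x"
      using weak[OF xy] by (auto simp: sel_less_def sel_le_def insert_commute)
    show "sel_less \<phi> x y \<Longrightarrow> \<not> sel_less \<phi> y x"
      by (auto simp: sel_less_def sel_le_def insert_commute)
    show "sel_less \<phi> x y \<Longrightarrow>
      \<exists>U V. openin T U \<and> openin T V \<and> x \<in> U \<and> y \<in> V \<and> (\<forall>s\<in>U. \<forall>t\<in>V. sel_less \<phi> s t)"
      using \<phi> xy unfolding continuous_weak_selection_def by blast
  next
    show "T = topology_generated_by (insert ?X ({{y \<in> ?X. sel_less \<phi> y x} |x. x \<in> ?X} \<union>
        {{y \<in> ?X. sel_less \<phi> x y} |x. x \<in> ?X}))"
      using T unfolding selection_topology_def .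
  next
    fix R assume "open_tournament T R"
    then show "\<exists>q\<in>?X. \<forall>x\<in>?X. (\<lambda>u v. u \<in> ?X \<and> v \<in> ?X \<and> R u v)\<^sup>*\<^sup>* x q"
      by (rule open_tournament_has_quasi_king[OF assms(3)])
  qed
  show ?thesis
    by (rule compact_if_quasi_kings)
qed

end
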